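(* Let $A\in\mathbb{C}^{n\times n}$, $1\le k\le n$, and $(a,b)\in\mathbb{R}^2$. The following are equivalent: (a) $a+ib\in\Lambda_k(A)$; (b) for all $(t,x,y)\in\mathbb{R}^3$ with $t+ax+by=0$, the matrix $tI_n+x\Re(A)+y\Im(A)$ has at most $n-k$ strictly positive eigenvalues; (c) for all $(t,x,y)\in\mathbb{R}^3$ with $t+ax+by=0$, the matrix $tI_n+x\Re(A)+y\Im(A)$ has at most $n-k$ strictly negative eigenvalues; (d) $\lambda_{n-k+1}(x\Re(A)+y\Im(A))\le ax+by$ for all $(x,y)\in\mathbb{R}^2$; (e) $\lambda_k(x\Re(A)+y\Im(A))\ge ax+by$ for all $(x,y)\in\mathbb{R}^2$; (f) $\lambda_k(\Re(A)+y\Im(A))\ge a+by$ and $\lambda_{n-k+1}(\Re(A)+y\Im(A))\le a+by$ for all $y\in\mathbb{R}$.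
   Context: For $A\in\mathbb{C}^{n\times n}$ put $\Re(A)=\frac12(A+A^* )$ and $\Im(A)=\frac{1}{2i}(A-A^* )$, both Hermitian. For a Hermitian $n\times n$ matrix $M$, $\lambda_1(M)\ge\dots\ge\lambda_n(M)$ are its eigenvalues with multiplicity (and eigenvalues are counted with multiplicity in (b), (c)). The rank-$k$ numerical range is $\Lambda_k(A)=\{\mu\in\mathbb{C}: \exists X\in\mathbb{C}^{n\times k} \text{ with } X^*X=I_k,\ X^*AX=\mu I_k\}$. *)

theory Defs
  imports "Jordan_Normal_Form.Schur_Decomposition"
    "HOL-Computational_Algebra.Fundamental_Theorem_Algebra"
begin

definition mat_Re :: "complex mat \<Rightarrow> complex mat" where
  "mat_Re A = (1 / 2) \<cdot>\<^sub>m (A + mat_adjoint A)"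

definition mat_Im :: "complex mat \<Rightarrow> complex mat" where
  "mat_Im A = (1 / (2 * \<i>)) \<cdot>\<^sub>m (A - mat_adjoint A)"

definition rank_numerical_range :: "nat \<Rightarrow> complex mat \<Rightarrow> complex set" where
  "rank_numerical_range k A =
    {\<mu>. \<exists>X \<in> carrier_mat (dim_row A) k.
          mat_adjoint X * X = 1\<^sub>m k \<and> mat_adjoint X * A * X = \<mu> \<cdot>\<^sub>m 1\<^sub>m k}"

text \<open>
  The eigenvalues with multiplicity of a Hermitian matrix, as real numbers. All of them are
  real, so taking real parts loses nothing (see \<open>image_of_real_herm_eigvals\<close> below); on
  matrices that are not Hermitian the definition has no meaning.
\<close>

definition herm_eigvals :: "complex mat \<Rightarrow> real multiset" where
  "herm_eigvals M = image_mset Re (proots (char_poly M))"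

text \<open>The \<open>j\<close>-th largest eigenvalue, counted from \<open>j = 1\<close>; meaningful for \<open>1 \<le> j \<le> n\<close> only.\<close>

definition herm_eigval :: "nat \<Rightarrow> complex mat \<Rightarrow> real" where
  "herm_eigval j M = rev (sorted_list_of_multiset (herm_eigvals M)) ! (j - 1)"

definition num_pos_eigvals :: "complex mat \<Rightarrow> nat" where
  "num_pos_eigvals M = size {#e \<in># herm_eigvals M. 0 < e#}"

definition num_neg_eigvals :: "complex mat \<Rightarrow> nat" where
  "num_neg_eigvals M = size {#e \<in># herm_eigvals M. e < 0#}"

lemma dim_mat_adjoint [simp]:
  "dim_row (mat_adjoint M) = dim_col M" "dim_col (mat_adjoint M) = dim_row M"
  unfolding mat_adjoint_def by auto

lemma mat_adjoint_carrier [simp]: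
  "M \<in> carrier_mat m n \<Longrightarrow> mat_adjoint M \<in> carrier_mat n m"
  unfolding mat_adjoint_def by auto

lemma index_mat_adjoint:
  assumes "i < dim_col M" "j < dim_row M"
  shows "mat_adjoint M $$ (i, j) = conjugate (M $$ (j, i))"
  using assms unfolding mat_adjoint_def by (simp add: mat_of_rows_index)

lemma mat_Re_carrier [simp]:
  assumes "A \<in> carrier_mat n n"
  shows "mat_Re A \<in> carrier_mat n n"
  unfolding mat_Re_def
  by (intro smult_carrier_mat add_carrier_mat mat_adjoint_carrier assms)

lemma mat_Im_carrier [simp]:
  assumes "A \<in> carrier_mat n n"
  shows "mat_Im A \<in> carrier_mat n n"
  unfolding mat_Im_def
  by (intro smult_carrier_mat minus_carrier_mat mat_adjoint_carrier assms)

lemma index_mat_Re: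
  assumes "A \<in> carrier_mat n n" "i < n" "j < n"
  shows "mat_Re A $$ (i, j) = (A $$ (i, j) + cnj (A $$ (j, i))) / 2"
  using assms unfolding mat_Re_def by (auto simp: index_mat_adjoint field_simps)

lemma mat_adjoint_mat_Re:
  assumes "A \<in> carrier_mat n n"
  shows "mat_adjoint (mat_Re A) = mat_Re A"
proof (rule eq_matI)
  have c: "mat_Re A \<in> carrier_mat n n" using assms by simp
  fix i j assume "i < dim_row (mat_Re A)" "j < dim_col (mat_Re A)"
  then have "i < n" "j < n" using c by (auto simp del: mat_Re_carrier)
  then show "mat_adjoint (mat_Re A) $$ (i, j) = mat_Re A $$ (i, j)"
    using carrier_matD[OF c]
    by (simp add: index_mat_adjoint index_mat_Re[OF assms] complex_eq_iff)
qed (use mat_Re_carrier[OF assms] in \<open>auto simp del: mat_Re_carrier\<close>)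

lemma index_mat_Im:
  assumes "A \<in> carrier_mat n n" "i < n" "j < n"
  shows "mat_Im A $$ (i, j) = (A $$ (i, j) - cnj (A $$ (j, i))) / (2 * \<i>)"
  using assms unfolding mat_Im_def by (auto simp: index_mat_adjoint field_simps)

lemma mat_adjoint_mat_Im:
  assumes "A \<in> carrier_mat n n"
  shows "mat_adjoint (mat_Im A) = mat_Im A"
proof (rule eq_matI)
  have c: "mat_Im A \<in> carrier_mat n n" using assms by simp
  fix i j assume "i < dim_row (mat_Im A)" "j < dim_col (mat_Im A)"
  then have "i < n" "j < n" using c by (auto simp del: mat_Re_carrier)
  then show "mat_adjoint (mat_Im A) $$ (i, j) = mat_Im A $$ (i, j)"
    using carrier_matD[OF c]
    by (simp add: index_mat_adjoint index_mat_Im[OF assms] complex_eq_iff)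
      (simp add: field_simps)
qed (use mat_Im_carrier[OF assms] in \<open>auto simp del: mat_Im_carrier\<close>)

lemma eigenvalue_hermitian_real:
  fixes M :: "complex mat"
  assumes M: "M \<in> carrier_mat n n" and herm: "mat_adjoint M = M" and ev: "eigenvalue M e"
  shows "e \<in> \<real>"
proof -
  obtain v where v: "v \<in> carrier_vec n" "v \<noteq> 0\<^sub>v n" "M *\<^sub>v v = e \<cdot>\<^sub>v v"
    using ev M unfolding eigenvalue_def eigenvector_def by auto
  define q where "q = (\<Sum>i<n. \<Sum>j<n. cnj (v $ i) * M $$ (i, j) * v $ j)"
  define s where "s = (\<Sum>i<n. (cmod (v $ i))\<^sup>2)"
  have row: "(\<Sum>j<n. M $$ (i, j) * v $ j) = e * v $ i" if "i < n" for i
  proof -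
    have "(M *\<^sub>v v) $ i = (\<Sum>j<n. M $$ (i, j) * v $ j)"
      using that M v(1) by (simp add: scalar_prod_def atLeast0LessThan)
    then show ?thesis using v that by simp
  qed
  have "q = (\<Sum>i<n. cnj (v $ i) * (e * v $ i))"
    unfolding q_def by (intro sum.cong refl) (simp add: row[symmetric] sum_distrib_left mult.assoc)
  also have "\<dots> = e * of_real s"
    unfolding s_def of_real_sum sum_distrib_left
    by (intro sum.cong refl) (simp add: complex_norm_square mult_ac del: of_real_power)
  finally have qs: "q = e * of_real s" .
  have "cnj (M $$ (i, j)) = M $$ (j, i)" if "i < n" "j < n" for i j
    using index_mat_adjoint[of j M i] herm M that by simp
  then have "cnj q = (\<Sum>i<n. \<Sum>j<n. cnj (v $ j) * M $$ (j, i) * v $ i)"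
    unfolding q_def cnj_sum by (intro sum.cong refl) (simp add: mult_ac)
  also have "\<dots> = q" unfolding q_def by (rule sum.swap)
  finally have "cnj e * of_real s = e * of_real s" using qs by simp
  moreover have "s \<noteq> 0"
  proof
    assume "s = 0"
    then have "v $ i = 0" if "i < n" for i
      using that unfolding s_def by (subst (asm) sum_nonneg_eq_0_iff) auto
    then have "v = 0\<^sub>v n" using v(1) by (intro eq_vecI) auto
    with v(2) show False by simp
  qed
  ultimately show ?thesis by (simp add: Reals_cnj_iff)
qed

lemma image_of_real_herm_eigvals:
  assumes M: "M \<in> carrier_mat n n" and herm: "mat_adjoint M = M"
  shows "image_mset complex_of_real (herm_eigvals M) = proots (char_poly M)"
proof -
  have "char_poly M \<noteq> 0" using degree_monic_char_poly[OF M] by auto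
  then have "e \<in> \<real>" if "e \<in># proots (char_poly M)" for e
    using that eigenvalue_hermitian_real[OF M herm] by (simp add: eigenvalue_root_char_poly[OF M])
  then have "image_mset (complex_of_real \<circ> Re) (proots (char_poly M))
      = image_mset id (proots (char_poly M))"
    by (intro image_mset_cong) auto
  then show ?thesis by (simp add: herm_eigvals_def multiset.map_comp)
qed

lemma size_herm_eigvals:
  assumes M: "M \<in> carrier_mat n n"
  shows "size (herm_eigvals M) = n"
  using degree_monic_char_poly[OF M] by (simp add: herm_eigvals_def size_proots_complex)

end

(*
  Replacing A by A - (a + ib) I, with Hermitian parts h and g, the claim is that h and g vanish on a
  common k-dimensional subspace as soon as every real combination x h + y g has negative index at
  most n - k. This is proved by induction on k, for forms on a subspace U. Call an isotropic v
  reducing if h(v,.) and g(v,.) are linearly dependent on U; passing to a complement of v in its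
  orthogonal space then lowers k by one. A reducing vector exists in two situations:
  - some form of the pencil has fewer than k positive eigenvalues: on its radical the derivative of
    the pencil cannot be definite, since otherwise rotating slightly would violate the index bound;
  - dim U = 2k: either the pencil is degenerate somewhere, which is the first situation, or it has
    a nonreal eigenvalue, whose eigenvectors are isotropic for both forms.
  In general, shift h by real multiples of the identity in both directions up to the last value where
  the index bound holds. There the first situation occurs, which gives k-dimensional X1 and X2 with
  g = 0 and h positive, respectively negative, a multiple of the identity. The index bound holds on
  X1 + X2 by construction, and its dimension is 2k.
*)

theory Submission
  imports Defs "HOL-Library.Function_Algebras" "HOL-Library.Quadratic_Discriminant"
begin

text \<open>The induction works because a reducing vector \<open>v\<close> costs few dimensions.
  Linear dependence of h(v,.) and g(v,.) makes their common kernel of codimension at most one, and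
  splitting off \<open>v\<close> costs one more. A negative subspace of the rest can be enlarged
  inside \<open>U\<close> by a vector that pairs nontrivially with \<open>v\<close>. So dim U drops
  by at most two while k and the negative index drop by one each, which preserves the bound. For a
  common isotropic vector without the dependence the codimension can be three, and the count fails.
  Indices are measured by dimensions of definite subspaces: these need no basis, restrict to
  subspaces and survive small perturbations. The bound itself is not inherited by a smaller
  subspace, since dim U - k shrinks with it. This is why two opposite shifts are made: on their span
  of dimension 2k the bound has a proof of its own, by X1 for the combinations with x >= 0 and by X2
  for those with x < 0. The converse is a dimension count: a common isotropic subspace meets every
  negative subspace only in 0.\<close>

text \<open>Serves \<open>boundary_shift\<close>, where pencil parameters are passed to a limit;
  normalizing them to the circle keeps the limit away from (0, 0).\<close>

lemma unit_circle_convergent_subsequence: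
  fixes X Y :: "nat \<Rightarrow> real"
  assumes "\<And>m. (X m)\<^sup>2 + (Y m)\<^sup>2 = 1"
  obtains r x y where "strict_mono r" "(\<lambda>m. X (r m)) \<longlonglongrightarrow> x" "(\<lambda>m. Y (r m)) \<longlonglongrightarrow> y" "x\<^sup>2 + y\<^sup>2 = 1"
proof -
  have "(X m)\<^sup>2 \<le> 1" "(Y m)\<^sup>2 \<le> 1" for m
    using assms[of m] zero_le_power2[of "X m"] zero_le_power2[of "Y m"] by linarith+
  then have bd: "\<bar>X m\<bar> \<le> 1" "\<bar>Y m\<bar> \<le> 1" for m
    by (simp_all add: abs_square_le_1)
  have sub: "\<exists>r. strict_mono r \<and> convergent (\<lambda>m. Z (r m))" if "\<And>m. \<bar>Z m\<bar> \<le> 1" for Z :: "nat \<Rightarrow> real"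
  proof -
    obtain r where r: "strict_mono r" "monoseq (\<lambda>m. Z (r m))" using seq_monosub by blast
    have "Bseq (\<lambda>m. Z (r m))" using that by (intro BseqI'[of _ 1]) simp
    then show ?thesis using r Bseq_monoseq_convergent by blast
  qed
  obtain r1 x where r1: "strict_mono r1" "(\<lambda>m. X (r1 m)) \<longlonglongrightarrow> x"
    using sub[of X] bd unfolding convergent_def by blast
  obtain r2 y where r2: "strict_mono r2" "(\<lambda>m. Y (r1 (r2 m))) \<longlonglongrightarrow> y"
    using sub[of "\<lambda>m. Y (r1 m)"] bd unfolding convergent_def by blast
  have X: "(\<lambda>m. X (r1 (r2 m))) \<longlonglongrightarrow> x"
    using LIMSEQ_subseq_LIMSEQ[OF r1(2) r2(1)] by (simp add: o_def)
  have "(\<lambda>m. (X (r1 (r2 m)))\<^sup>2 + (Y (r1 (r2 m)))\<^sup>2) \<longlonglongrightarrow> x\<^sup>2 + y\<^sup>2"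
    by (intro tendsto_intros X r2(2))
  then have "x\<^sup>2 + y\<^sup>2 = 1" unfolding assms using LIMSEQ_const_iff by metis
  moreover have "strict_mono (r1 \<circ> r2)" using r1(1) r2(1) by (rule strict_mono_o)
  ultimately show ?thesis using that[of "r1 \<circ> r2" x y] X r2(2) by simp
qed

section \<open>Hermitian forms on finite-dimensional subspaces\<close>

locale complex_space = vector_space scale
  for scale :: "complex \<Rightarrow> 'a::ab_group_add \<Rightarrow> 'a" (infixr "*s" 75)
begin

text \<open>The vector type used later is infinite dimensional, and \<open>dim\<close> is a
  cardinality, hence 0 for a subspace without a finite basis. Finite generation is therefore carried
  along for each subspace.\<close>

definition fin_subspace :: "'a set \<Rightarrow> bool" where
  "fin_subspace U \<longleftrightarrow> (\<exists>C. finite C \<and> U = span C)"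

lemma fin_subspace_span [intro]: "finite C \<Longrightarrow> fin_subspace (span C)"
  unfolding fin_subspace_def by blast

lemma fin_subspace_imp_subspace: "fin_subspace U \<Longrightarrow> subspace U"
  unfolding fin_subspace_def by auto

lemma fin_subspace_basis:
  assumes "fin_subspace U" "subspace V" "V \<subseteq> U"
  obtains B where "finite B" "independent B" "V = span B" "card B = dim V"
proof -
  obtain C where C: "finite C" "U = span C" using assms unfolding fin_subspace_def by auto
  obtain B where B: "B \<subseteq> V" "independent B" "V \<subseteq> span B" "card B = dim V"
    by (rule basis_exists)
  have "finite B" using independent_span_bound[OF C(1) B(2)] B(1) assms(3) C(2) by auto
  moreover have "V = span B" using B assms(2) span_minimal by blast
  ultimately show ?thesis using that B by auto
qed

lemma fin_subspace_subset: "fin_subspace U \<Longrightarrow> subspace V \<Longrightarrow> V \<subseteq> U \<Longrightarrow> fin_subspace V"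
  by (metis fin_subspace_basis fin_subspace_span)

lemma dim_subset_fin:
  assumes "fin_subspace U" "V \<subseteq> U"
  shows "dim V \<le> dim U"
proof -
  obtain B where "finite B" "U = span B" "card B = dim U"
    using fin_subspace_basis[OF assms(1) fin_subspace_imp_subspace[OF assms(1)]] by auto
  then show ?thesis using dim_le_card[of V B] assms(2) by auto
qed

lemma span_insert_span: "span (insert z (span B)) = span (insert z B)"
  unfolding span_insert by (simp only: span_span)

lemma dim_span_insert:
  assumes "fin_subspace Q" "z \<notin> Q"
  shows "dim (span (insert z Q)) = Suc (dim Q)"
proof -
  obtain B where B: "finite B" "independent B" "Q = span B" "card B = dim Q"
    using fin_subspace_basis[OF assms(1) fin_subspace_imp_subspace[OF assms(1)]] by auto
  have "z \<notin> B" using assms(2) B(3) span_base by blast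
  moreover have "independent (insert z B)" using independent_insertI[of z B] B assms by auto
  moreover have "span (insert z Q) = span (insert z B)"
    unfolding B(3) by (rule span_insert_span)
  ultimately show ?thesis using B dim_span_eq_card_independent[of "insert z B"] by simp
qed

lemma fin_subspace_span_insert:
  assumes "fin_subspace Q" shows "fin_subspace (span (insert z Q))"
proof -
  obtain C where C: "finite C" "Q = span C" using assms unfolding fin_subspace_def by auto
  have "span (insert z Q) = span (insert z C)"
    unfolding C(2) by (rule span_insert_span)
  then show ?thesis using C by auto
qed

text \<open>If a new \<open>x\<close> depended on \<open>A\<close> and \<open>B\<close>, split it as
  p + q; then p = x - q lies in both spans, so it is 0 and \<open>x\<close> would depend on
  \<open>B\<close> alone.\<close>

lemma independent_Un:
  assumes "independent A" "independent B" "finite B" "span A \<inter> span B = {0}"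
  shows "independent (A \<union> B) \<and> A \<inter> B = {}"
  using assms(3,2,4)
proof (induction B rule: finite_induct)
  case empty then show ?case using assms(1) by simp
next
  case (insert x B)
  have iB: "independent B" and xB: "x \<notin> span B"
    using insert.prems(1) insert.hyps(2) independent_insert[of x B] by auto
  have sub: "span B \<subseteq> span (insert x B)" by (intro span_mono) auto
  have "span A \<inter> span B = {0}" using insert.prems(2) sub span_zero by blast
  then have IH: "independent (A \<union> B)" "A \<inter> B = {}" using insert.IH iB by auto
  have x0: "x \<noteq> 0" using xB span_zero by auto
  have xs: "x \<in> span (insert x B)" by (simp add: span_base)
  have xA: "x \<notin> A" using insert.prems(2) xs x0 span_base by blast
  have "x \<notin> span (A \<union> B)"
  proof
    assume "x \<in> span (A \<union> B)"
    then obtain p q where pq: "x = p + q" "p \<in> span A" "q \<in> span B" unfolding span_Un by auto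
    have "p = x - q" using pq by simp
    then have "p \<in> span (insert x B)" using span_diff[OF xs] sub pq(3) by auto
    then have "p = 0" using pq(2) insert.prems(2) by blast
    then show False using pq xB by simp
  qed
  then show ?case using independent_insertI IH xA by simp
qed

text \<open>All index estimates below rest on this count: subspaces on which a form has incompatible
  signs share only 0.\<close>

lemma dim_add_le_of_Int:
  assumes "fin_subspace U" "subspace P" "subspace Q" "P \<subseteq> U" "Q \<subseteq> U" "P \<inter> Q = {0}"
  shows "dim P + dim Q \<le> dim U"
proof -
  obtain A where A: "finite A" "independent A" "P = span A" "card A = dim P"
    using fin_subspace_basis assms by metis
  obtain B where B: "finite B" "independent B" "Q = span B" "card B = dim Q"
    using fin_subspace_basis assms by metis
  have *: "independent (A \<union> B)" "A \<inter> B = {}"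
    using independent_Un[of A B] A B assms(6) by auto
  have "A \<union> B \<subseteq> U" using A B assms span_superset by blast
  then have "dim (A \<union> B) \<le> dim U" by (rule dim_subset_fin[OF assms(1)])
  then show ?thesis using * A B dim_eq_card_independent[OF *(1)] by (simp add: card_Un_disjoint)
qed

lemma nonzero_in_Int:
  assumes "fin_subspace U" "subspace P" "subspace Q" "P \<subseteq> U" "Q \<subseteq> U"
    "dim P + dim Q > dim U"
  obtains v where "v \<in> P" "v \<in> Q" "v \<noteq> 0"
proof -
  have "P \<inter> Q \<noteq> {0}" using dim_add_le_of_Int[OF assms(1-5)] assms(6) by auto
  then show ?thesis using that subspace_0[OF assms(2)] subspace_0[OF assms(3)] by blast
qed

lemma dim_span_Un_disjoint:
  assumes "fin_subspace P" "fin_subspace Q" "P \<inter> Q = {0}"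
  shows "dim (span (P \<union> Q)) = dim P + dim Q" "fin_subspace (span (P \<union> Q))"
proof -
  obtain A where A: "finite A" "independent A" "P = span A" "card A = dim P"
    using fin_subspace_basis[OF assms(1) fin_subspace_imp_subspace[OF assms(1)]] by auto
  obtain B where B: "finite B" "independent B" "Q = span B" "card B = dim Q"
    using fin_subspace_basis[OF assms(2) fin_subspace_imp_subspace[OF assms(2)]] by auto
  have *: "independent (A \<union> B)" "A \<inter> B = {}"
    using independent_Un[of A B] A B assms by auto
  have s: "span (P \<union> Q) = span (A \<union> B)" unfolding A(3) B(3) span_Un by (simp only: span_span)
  show "dim (span (P \<union> Q)) = dim P + dim Q"
    unfolding s using * A B dim_eq_card_independent[OF *(1)] by (simp add: card_Un_disjoint)
  show "fin_subspace (span (P \<union> Q))" unfolding s using A B by auto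
qed

text \<open>Each linear condition such as h(v,.) = 0 costs at most one dimension: any vector outside
  the kernel spans \<open>U\<close> together with the kernel.\<close>

lemma dim_kernel:
  assumes "fin_subspace U"
    and add: "\<And>u w. u \<in> U \<Longrightarrow> w \<in> U \<Longrightarrow> \<phi> (u + w) = \<phi> u + (\<phi> w :: complex)"
    and scale: "\<And>c u. u \<in> U \<Longrightarrow> \<phi> (c *s u) = c * \<phi> u"
  shows "subspace {w\<in>U. \<phi> w = 0}" "dim U \<le> Suc (dim {w\<in>U. \<phi> w = 0})"
proof -
  let ?W = "{w\<in>U. \<phi> w = 0}"
  have U: "subspace U" using fin_subspace_imp_subspace assms(1) by auto
  show W: "subspace ?W"
    using U add scale scale[of 0 0] by (auto simp: subspace_def)
  show "dim U \<le> Suc (dim ?W)"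
  proof (cases "\<exists>u\<in>U. \<phi> u \<noteq> 0")
    case False
    then have "?W = U" by auto
    then show ?thesis by simp
  next
    case True
    then obtain u where u: "u \<in> U" "\<phi> u \<noteq> 0" by auto
    have "U \<subseteq> span (insert u ?W)"
    proof
      fix w assume w: "w \<in> U"
      define c where "c = \<phi> w / \<phi> u"
      have eq: "w = c *s u + (w - c *s u)" by simp
      have m: "w - c *s u \<in> U" using w u U by (simp add: subspace_diff subspace_scale)
      have "\<phi> w = \<phi> (c *s u) + \<phi> (w - c *s u)"
        using add[of "c *s u" "w - c *s u"] m u U by (simp add: subspace_scale)
      then have "\<phi> (w - c *s u) = 0" using scale u unfolding c_def by simp
      with m have "w - c *s u \<in> ?W" by simp
      then have "w - c *s u \<in> span ?W" by (rule span_base)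
      then show "w \<in> span (insert u ?W)" unfolding span_insert by blast
    qed
    then have "dim U \<le> dim (span (insert u ?W))"
      by (intro dim_subset_fin fin_subspace_span_insert fin_subspace_subset[OF assms(1) W]) auto
    also have "\<dots> = Suc (dim ?W)"
      by (rule dim_span_insert) (use u fin_subspace_subset[OF assms(1) W] in auto)
    finally show ?thesis .
  qed
qed

section \<open>Hermitian forms and orthonormal bases\<close>

text \<open>Forms live on the whole space, so passing to a smaller subspace in an induction changes
  no form. Conjugate linearity in the first argument follows from linearity in the second and the
  symmetry.\<close>

definition hermitian_form :: "('a \<Rightarrow> 'a \<Rightarrow> complex) \<Rightarrow> bool" where
  "hermitian_form f \<longleftrightarrow>
     (\<forall>u v w. f u (v + w) = f u v + f u w) \<and> (\<forall>c u v. f u (c *s v) = c * f u v) \<and>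
     (\<forall>u v. f v u = cnj (f u v))"

lemma hermitian_formD:
  assumes "hermitian_form f"
  shows "f u (v + w) = f u v + f u w" "f (v + w) u = f v u + f w u"
    "f u (c *s v) = c * f u v" "f (c *s v) u = cnj c * f v u"
    "f u 0 = 0" "f 0 u = 0" "f u (- v) = - f u v" "f (- v) u = - f v u"
    "f u (v - w) = f u v - f u w" "f (v - w) u = f v u - f w u"
proof -
  have a: "f u (v + w) = f u v + f u w" for u v w using assms unfolding hermitian_form_def by blast
  have s: "f u (c *s v) = c * f u v" for c u v using assms unfolding hermitian_form_def by blast
  have c: "f v u = cnj (f u v)" for u v using assms unfolding hermitian_form_def by blast
  have s': "f (c *s v) u = cnj c * f v u" for c u v by (subst (1 2) c) (simp add: s)
  have a': "f (v + w) u = f v u + f w u" for u v w by (subst (1 2 3) c) (simp add: a)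
  have m: "f u (- v) = - f u v" for u v using s[of u "-1" v] by simp
  have m': "f (- v) u = - f v u" for u v using s'[of "-1" v u] by simp
  show "f u (v + w) = f u v + f u w" by (rule a)
  show "f u (c *s v) = c * f u v" by (rule s)
  show "f (c *s v) u = cnj c * f v u" by (rule s')
  show "f (v + w) u = f v u + f w u" by (rule a')
  show "f u (- v) = - f u v" by (rule m)
  show "f (- v) u = - f v u" by (rule m')
  show "f u 0 = 0" using s[of u 0 0] by simp
  show "f 0 u = 0" using s'[of 0 0 u] by simp
  show "f u (v - w) = f u v - f u w" using a[of u v "-w"] m by simp
  show "f (v - w) u = f v u - f w u" using a'[of v "-w" u] m' by simp
qed

lemma hermitian_form_cnj: "hermitian_form f \<Longrightarrow> f v u = cnj (f u v)"
  unfolding hermitian_form_def by blast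

lemma hermitian_form_zero_sym: "hermitian_form f \<Longrightarrow> f v u = 0 \<longleftrightarrow> f u v = 0"
  by (metis hermitian_form_cnj complex_cnj_zero)

lemma hermitian_form_self: "hermitian_form f \<Longrightarrow> f u u = of_real (Re (f u u))"
  using hermitian_form_cnj[of f u u] by (simp add: complex_eq_iff)

lemma hermitian_form_sum:
  assumes "hermitian_form f"
  shows "f u (\<Sum>i\<in>I. w i) = (\<Sum>i\<in>I. f u (w i))" "f (\<Sum>i\<in>I. w i) u = (\<Sum>i\<in>I. f (w i) u)"
  by (induction I rule: infinite_finite_induct; simp add: hermitian_formD[OF assms])+

lemma hermitian_form_lincomb:
  assumes "hermitian_form f" "hermitian_form g"
  shows "hermitian_form (\<lambda>u w. of_real x * f u w + of_real y * g u w)"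
  unfolding hermitian_form_def
proof (intro conjI allI)
  fix u v
  show "of_real x * f v u + of_real y * g v u = cnj (of_real x * f u v + of_real y * g u v)"
    using hermitian_form_cnj[OF assms(1), of v u] hermitian_form_cnj[OF assms(2), of v u] by simp
qed (simp_all add: hermitian_formD[OF assms(1)] hermitian_formD[OF assms(2)] algebra_simps)

lemma hermitian_form_uminus:
  assumes "hermitian_form f"
  shows "hermitian_form (\<lambda>u w. - f u w)"
  unfolding hermitian_form_def
proof (intro conjI allI)
  fix u v
  show "- f v u = cnj (- f u v)" using hermitian_form_cnj[OF assms, of v u] by simp
qed (simp_all add: hermitian_formD[OF assms])

text \<open>The real part loses nothing, as f(u,u) is real by \<open>hermitian_form_self\<close>.
  Negativity is expressed through the negated form, so that every fact about positive subspaces also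
  serves negative ones.\<close>

definition pos_on :: "('a \<Rightarrow> 'a \<Rightarrow> complex) \<Rightarrow> 'a set \<Rightarrow> bool" where
  "pos_on f P \<longleftrightarrow> (\<forall>u\<in>P. u \<noteq> 0 \<longrightarrow> 0 < Re (f u u))"

abbreviation neg_on :: "('a \<Rightarrow> 'a \<Rightarrow> complex) \<Rightarrow> 'a set \<Rightarrow> bool" where
  "neg_on f \<equiv> pos_on (\<lambda>u w. - f u w)"

lemma pos_onD: "pos_on f P \<Longrightarrow> u \<in> P \<Longrightarrow> u \<noteq> 0 \<Longrightarrow> 0 < Re (f u u)"
  unfolding pos_on_def by blast

lemma pos_on_subset: "pos_on f P \<Longrightarrow> Q \<subseteq> P \<Longrightarrow> pos_on f Q"
  unfolding pos_on_def by blast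

definition orthonormal :: "('a \<Rightarrow> 'a \<Rightarrow> complex) \<Rightarrow> 'a set \<Rightarrow> bool" where
  "orthonormal f B \<longleftrightarrow> (\<forall>u\<in>B. \<forall>w\<in>B. f u w = (if u = w then 1 else 0))"

lemma orthonormal_expansion:
  assumes f: "hermitian_form f" and B: "finite B" "orthonormal f B" and u: "u \<in> span B"
  shows "u = (\<Sum>b\<in>B. f b u *s b)"
proof -
  obtain c where c: "u = (\<Sum>b\<in>B. c b *s b)" using u span_finite[OF B(1)] by auto
  have "f b u = c b" if "b \<in> B" for b
  proof -
    have "f b u = (\<Sum>b'\<in>B. c b' * f b b')" unfolding c
      by (simp add: hermitian_form_sum[OF f] hermitian_formD[OF f])
    also have "\<dots> = (\<Sum>b'\<in>B. if b' = b then c b else 0)"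
      using B(2) that unfolding orthonormal_def by (intro sum.cong) auto
    finally show ?thesis using that B(1) by simp
  qed
  then show ?thesis unfolding c by (intro sum.cong) auto
qed

lemma orthonormal_independent:
  assumes f: "hermitian_form f" and B: "finite B" "orthonormal f B"
  shows "independent B"
proof (rule independent_if_scalars_zero[OF B(1)])
  fix c x assume s: "(\<Sum>x\<in>B. c x *s x) = 0" and x: "x \<in> B"
  have "0 = f x (\<Sum>b\<in>B. c b *s b)" using s by (simp add: hermitian_formD[OF f])
  also have "\<dots> = (\<Sum>b\<in>B. c b * f x b)"
    by (simp add: hermitian_form_sum[OF f] hermitian_formD[OF f])
  also have "\<dots> = (\<Sum>b\<in>B. if b = x then c x else 0)"
    using B(2) x unfolding orthonormal_def by (intro sum.cong) auto
  finally show "c x = 0" using x B(1) by simp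
qed

lemma orthonormal_card:
  assumes "hermitian_form f" "finite B" "orthonormal f B"
  shows "card B = dim (span B)"
  using orthonormal_independent[OF assms] dim_span_eq_card_independent by simp

lemma orthonormal_extend:
  assumes f: "hermitian_form f" and B: "finite B" "orthonormal f B"
    and x: "\<And>b. b \<in> B \<Longrightarrow> f b x = 0" and p: "0 < Re (f x x)"
  obtains c where "c \<noteq> 0" "orthonormal f (insert (c *s x) B)" "c *s x \<notin> B"
proof -
  define r where "r = sqrt (Re (f x x))"
  define c where "c = complex_of_real (1 / r)"
  have r: "r > 0" using p unfolding r_def by simp
  have "f x x = of_real (r^2)" using hermitian_form_self[OF f, of x] p unfolding r_def by simp
  then have 1: "f (c *s x) (c *s x) = 1" using r
    by (simp add: hermitian_formD[OF f] c_def power2_eq_square)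
  have 2: "f b (c *s x) = 0" if "b \<in> B" for b using x[OF that] by (simp add: hermitian_formD[OF f])
  have "f (c *s x) b = 0" if "b \<in> B" for b
    using 2[OF that] hermitian_form_zero_sym[OF f] by blast
  then have "orthonormal f (insert (c *s x) B)"
    using B(2) 1 2 unfolding orthonormal_def by fastforce
  moreover have "c *s x \<notin> B" using 1 2 by fastforce
  moreover have "c \<noteq> 0" using r unfolding c_def by simp
  ultimately show ?thesis using that by blast
qed

text \<open>Gram-Schmidt along a finite generating set. The generators may be dependent; a zero
  remainder x - y is simply dropped.\<close>

lemma orthonormal_basis_exists:
  assumes f: "hermitian_form f" and U: "fin_subspace U" and p: "pos_on f U"
  obtains B where "finite B" "orthonormal f B" "U = span B"
proof -
  have "\<exists>B. finite B \<and> orthonormal f B \<and> span C = span B"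
    if "finite C" "pos_on f (span C)" for C
    using that
  proof (induction C rule: finite_induct)
    case empty
    show ?case by (rule exI[of _ "{}"]) (simp add: orthonormal_def)
  next
    case (insert x C)
    have sub: "span C \<subseteq> span (insert x C)" by (intro span_mono) auto
    then obtain B where B: "finite B" "orthonormal f B" "span C = span B"
      using insert.IH pos_on_subset[OF insert.prems] by blast
    define y where "y = (\<Sum>b\<in>B. f b x *s b)"
    have ys: "y \<in> span B" unfolding y_def by (intro span_sum span_scale span_base)
    have orth: "f b (x - y) = 0" if "b \<in> B" for b
    proof -
      have "f b y = (\<Sum>b'\<in>B. f b' x * f b b')" unfolding y_def
        by (simp add: hermitian_form_sum[OF f] hermitian_formD[OF f])
      also have "\<dots> = (\<Sum>b'\<in>B. if b' = b then f b x else 0)"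
        using B(2) that unfolding orthonormal_def by (intro sum.cong) auto
      finally show ?thesis using that B(1) by (simp add: hermitian_formD[OF f])
    qed
    have iC: "span (insert x C) = span (insert x B)"
      using B(3) by (simp only: span_insert)
    have iy: "span (insert x B) = span (insert (x - y) B)"
    proof -
      have m: "x \<in> span (insert x B)" "x - y \<in> span (insert (x - y) B)"
        "y \<in> span (insert x B)" "y \<in> span (insert (x - y) B)"
        using ys span_mono[of B "insert x B"] span_mono[of B "insert (x-y) B"]
        by (auto simp: span_base)
      have "x \<in> span (insert (x - y) B)" using span_add[OF m(2,4)] by simp
      moreover have "x - y \<in> span (insert x B)" using span_diff[OF m(1,3)] by simp
      moreover have "B \<subseteq> span (insert x B)" "B \<subseteq> span (insert (x - y) B)"
        using span_superset by blast+
      ultimately show ?thesis unfolding span_eq by auto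
    qed
    show ?case
    proof (cases "x - y = 0")
      case True
      then have "span (insert x C) = span B" using iC iy span_insert_0 by simp
      then show ?thesis using B by auto
    next
      case False
      have "x - y \<in> span (insert x C)" unfolding iC iy by (simp add: span_base)
      then have "0 < Re (f (x - y) (x - y))" using insert.prems False by (auto simp: pos_on_def)
      then obtain c where c: "c \<noteq> 0" "orthonormal f (insert (c *s (x - y)) B)"
        using orthonormal_extend[OF f B(1,2) orth] by blast
      have "span (insert (c *s (x - y)) B) = span (insert (x - y) B)"
      proof -
        have s: "x - y \<in> span (insert (x - y) B)" "c *s (x - y) \<in> span (insert (c *s (x - y)) B)"
          by (auto simp: span_base)
        have "x - y = (1 / c) *s (c *s (x - y))" using c(1) by simp
        then have "x - y \<in> span (insert (c *s (x - y)) B)" using span_scale[OF s(2)] by metis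
        moreover have "B \<subseteq> span (insert (c *s (x - y)) B)" "B \<subseteq> span (insert (x - y) B)"
          using span_superset by blast+
        ultimately show ?thesis unfolding span_eq using span_scale[OF s(1)] by auto
      qed
      then show ?thesis using iC iy c(2) B(1) by (intro exI[of _ "insert (c *s (x - y)) B"]) auto
    qed
  qed
  then show ?thesis using U p that unfolding fin_subspace_def by metis
qed

text \<open>The form may be indefinite outside \<open>E\<close>, and \<open>u\<close> is an
  arbitrary vector. Both matter later, where \<open>E\<close> is a definite subspace for a form of
  the pencil.\<close>

lemma orthogonal_projection:
  assumes f: "hermitian_form f" and E: "fin_subspace E" and p: "pos_on f E"
  obtains e where "e \<in> E" "\<And>w. w \<in> E \<Longrightarrow> f w (u - e) = 0"
proof -
  obtain B where B: "finite B" "orthonormal f B" "E = span B"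
    using orthonormal_basis_exists[OF f E p] .
  define e where "e = (\<Sum>b\<in>B. f b u *s b)"
  have eE: "e \<in> E" unfolding e_def B(3) by (intro span_sum span_scale span_base)
  have 1: "f b (u - e) = 0" if "b \<in> B" for b
  proof -
    have "f b e = (\<Sum>b'\<in>B. f b' u * f b b')" unfolding e_def
      by (simp add: hermitian_form_sum[OF f] hermitian_formD[OF f])
    also have "\<dots> = (\<Sum>b'\<in>B. if b' = b then f b u else 0)"
      using B(2) that unfolding orthonormal_def by (intro sum.cong) auto
    finally show ?thesis using that B(1) by (simp add: hermitian_formD[OF f])
  qed
  have "f w (u - e) = 0" if "w \<in> E" for w
  proof -
    have "f w (u - e) = f (\<Sum>b\<in>B. f b w *s b) (u - e)"
      using arg_cong[OF orthonormal_expansion[OF f B(1,2)], of w "\<lambda>z. f z (u - e)"] that B(3)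
      by blast
    also have "\<dots> = (\<Sum>b\<in>B. cnj (f b w) * f b (u - e))"
      by (simp only: hermitian_form_sum[OF f] hermitian_formD(4)[OF f])
    also have "\<dots> = 0" using 1 by simp
    finally show ?thesis .
  qed
  then show ?thesis using that eE by blast
qed

section \<open>Diagonalization of pairs of forms\<close>

definition diagonal_on :: "('a \<Rightarrow> 'a \<Rightarrow> complex) \<Rightarrow> 'a set \<Rightarrow> ('a \<Rightarrow> real) \<Rightarrow> bool" where
  "diagonal_on f B e \<longleftrightarrow> (\<forall>u\<in>B. \<forall>w\<in>B. f u w = (if u = w then of_real (e u) else 0))"

lemma orthonormal_eq_diagonal_on: "orthonormal f B \<longleftrightarrow> diagonal_on f B (\<lambda>_. 1)"
  unfolding orthonormal_def diagonal_on_def by simp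

lemma diagonal_onD:
  "diagonal_on f B e \<Longrightarrow> u \<in> B \<Longrightarrow> w \<in> B \<Longrightarrow> f u w = (if u = w then of_real (e u) else 0)"
  unfolding diagonal_on_def by blast

lemma form_diagonal_expansion:
  assumes n: "hermitian_form n" and g: "hermitian_form g"
    and B: "finite B" "orthonormal n B"
    and d: "diagonal_on g B e"
    and u: "u \<in> span B"
  shows "Re (g u u) = (\<Sum>b\<in>B. e b * (cmod (n b u))\<^sup>2)"
proof -
  define c where "c b = n b u" for b
  have eq: "u = (\<Sum>b\<in>B. c b *s b)" unfolding c_def by (rule orthonormal_expansion[OF n B u])
  have "g (\<Sum>b\<in>B. c b *s b) x = (\<Sum>b\<in>B. cnj (c b) * g b x)" for x
    by (simp only: hermitian_form_sum[OF g] hermitian_formD[OF g])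
  then have "g (\<Sum>b\<in>B. c b *s b) (\<Sum>b\<in>B. c b *s b)
      = (\<Sum>b\<in>B. cnj (c b) * g b (\<Sum>b\<in>B. c b *s b))" .
  also have "\<dots> = (\<Sum>b\<in>B. cnj (c b) * (\<Sum>b'\<in>B. c b' * g b b'))"
    by (simp only: hermitian_form_sum(1)[OF g] hermitian_formD(3)[OF g])
  also have "\<dots> = (\<Sum>b\<in>B. cnj (c b) * (c b * of_real (e b)))"
  proof (intro sum.cong refl)
    fix b assume b: "b \<in> B"
    have "(\<Sum>b'\<in>B. c b' * g b b') = (\<Sum>b'\<in>B. if b' = b then c b * of_real (e b) else 0)"
      using diagonal_onD[OF d b] by (intro sum.cong) auto
    then show "cnj (c b) * (\<Sum>b'\<in>B. c b' * g b b') = cnj (c b) * (c b * of_real (e b))"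
      using b B(1) by simp
  qed
  also have "\<dots> = of_real (\<Sum>b\<in>B. e b * (cmod (c b))\<^sup>2)"
    unfolding of_real_sum
    by (intro sum.cong refl) (simp add: complex_norm_square mult_ac del: of_real_power)
  finally have "g u u = of_real (\<Sum>b\<in>B. e b * (cmod (c b))\<^sup>2)" by (simp only: eq[symmetric])
  then show ?thesis by (simp only: Re_complex_of_real c_def)
qed

lemma norm_expansion:
  assumes n: "hermitian_form n" and B: "finite B" "orthonormal n B" and u: "u \<in> span B"
  shows "Re (n u u) = (\<Sum>b\<in>B. (cmod (n b u))\<^sup>2)"
  using form_diagonal_expansion[OF n n B _ u, of "\<lambda>_. 1"] B(2)
  by (simp add: orthonormal_eq_diagonal_on)

text \<open>The operator "inverse of f times g" on the span has a complex eigenvalue. Since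
  \<open>f\<close> may be indefinite, \<open>l\<close> may be nonreal, which
  \<open>reducing_vector_half_dim\<close> exploits; for definite \<open>f\<close> the lemma starts
  the simultaneous diagonalization.\<close>

lemma pencil_eigenvector:
  assumes f: "hermitian_form f" and g: "hermitian_form g" and B: "finite B" "B \<noteq> {}"
    and d: "diagonal_on f B e"
    and e: "\<And>u. u \<in> B \<Longrightarrow> e u \<noteq> 0"
  obtains l v where "v \<in> span B" "v \<noteq> 0" "\<And>w. w \<in> span B \<Longrightarrow> g w v = l * f w v"
proof -
  define N where "N = card B"
  obtain b where b: "bij_betw b {..<N} B"
    using ex_bij_betw_nat_finite[OF B(1)] unfolding N_def atLeast0LessThan by auto
  have N: "N > 0" using B unfolding N_def by (simp add: card_gt_0_iff)
  have bB: "b i \<in> B" if "i < N" for i using b that by (auto simp: bij_betw_def)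
  \<comment> \<open>The Gram matrix of \<open>f\<close> in this basis is diagonal, so multiplying
    the Gram matrix of \<open>g\<close> by its inverse divides row i by the i-th diagonal
    entry.\<close>
  define M where "M = mat N N (\<lambda>(i, j). g (b i) (b j) / of_real (e (b i)))"
  have M: "M \<in> carrier_mat N N" unfolding M_def by simp
  have "degree (char_poly M) = N" using degree_monic_char_poly[OF M] by simp
  then have "\<not> constant (poly (char_poly M))" using N by (simp add: constant_degree)
  then obtain l where "poly (char_poly M) l = 0" using fundamental_theorem_of_algebra by blast
  then have "eigenvalue M l" using eigenvalue_root_char_poly[OF M] by simp
  then obtain c where c: "c \<in> carrier_vec N" "c \<noteq> 0\<^sub>v N" "M *\<^sub>v c = l \<cdot>\<^sub>v c"
    using M unfolding eigenvalue_def eigenvector_def by auto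
  define v where "v = (\<Sum>j<N. (c $ j) *s b j)"
  have vs: "v \<in> span B" unfolding v_def by (intro span_sum span_scale span_base bB) auto
  have fb: "f (b i) v = of_real (e (b i)) * c $ i" if i: "i < N" for i
  proof -
    have "f (b i) v = (\<Sum>j<N. c $ j * f (b i) (b j))" unfolding v_def
      by (simp only: hermitian_form_sum[OF f] hermitian_formD[OF f])
    also have "\<dots> = (\<Sum>j<N. if j = i then of_real (e (b i)) * c $ i else 0)"
    proof (intro sum.cong refl)
      fix j assume "j \<in> {..<N}"
      then have "b i = b j \<longleftrightarrow> i = j" using b i by (auto simp: bij_betw_def inj_on_def)
      then show "c $ j * f (b i) (b j) = (if j = i then of_real (e (b i)) * c $ i else 0)"
        using diagonal_onD[OF d bB[OF i] bB[of j]] \<open>j \<in> {..<N}\<close> by auto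
    qed
    finally show ?thesis using i by simp
  qed
  have gb: "g (b i) v = l * f (b i) v" if i: "i < N" for i
  proof -
    have "(M *\<^sub>v c) $ i = (\<Sum>j<N. M $$ (i, j) * c $ j)"
      using i M c(1) by (simp add: scalar_prod_def atLeast0LessThan)
    then have "(\<Sum>j<N. M $$ (i, j) * c $ j) = l * c $ i" using c i by simp
    then have "l * c $ i = (\<Sum>j<N. g (b i) (b j) / of_real (e (b i)) * c $ j)"
      unfolding M_def using i by simp
    then have "of_real (e (b i)) * (l * c $ i)
        = of_real (e (b i)) * (\<Sum>j<N. g (b i) (b j) / of_real (e (b i)) * c $ j)" by simp
    also have "\<dots> = (\<Sum>j<N. c $ j * g (b i) (b j))"
      unfolding sum_distrib_left using e[OF bB[OF i]] by (intro sum.cong refl) simp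
    also have "\<dots> = g (b i) v" unfolding v_def
      by (simp only: hermitian_form_sum[OF g] hermitian_formD[OF g])
    finally show ?thesis using fb[OF i] by (simp add: mult_ac)
  qed
  have "v \<noteq> 0"
  proof
    assume "v = 0"
    then have "c $ i = 0" if "i < N" for i
      using fb[OF that] e[OF bB[OF that]] by (simp add: hermitian_formD[OF f])
    then show False using c(1,2) by (auto intro!: eq_vecI)
  qed
  moreover have "g w v = l * f w v" if "w \<in> span B" for w
    using that
  proof (induction rule: span_induct)
    case base
    show ?case unfolding subspace_def
      by (auto simp: hermitian_formD[OF f] hermitian_formD[OF g] algebra_simps)
  next
    case (step x)
    then obtain i where "i < N" "x = b i" using b by (auto simp: bij_betw_def)
    then show ?case using gb by simp
  qed
  ultimately show ?thesis using that vs by blast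
qed

text \<open>Induction on the dimension: an eigenvector of \<open>g\<close> relative to
  \<open>n\<close> is split off, and the induction continues on its \<open>n\<close>-orthogonal
  complement.\<close>

lemma simultaneous_diagonalization:
  assumes n: "hermitian_form n" and g: "hermitian_form g"
    and "fin_subspace U" "pos_on n U"
  obtains B e where "finite B" "orthonormal n B" "U = span B"
    "diagonal_on g B e"
proof -
  have "\<exists>B e. finite B \<and> orthonormal n B \<and> U = span B \<and> diagonal_on g B e"
    using assms(3,4)
  proof (induction "dim U" arbitrary: U rule: less_induct)
    case less
    obtain C where C: "finite C" "orthonormal n C" "U = span C"
      using orthonormal_basis_exists[OF n less.prems] .
    show ?case
    proof (cases "C = {}")
      case True
      then show ?thesis using C by (intro exI[of _ "{}"]) (auto simp: diagonal_on_def)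
    next
      case False
      obtain l v where v: "v \<in> span C" "v \<noteq> 0" "\<And>w. w \<in> span C \<Longrightarrow> g w v = l * n w v"
        by (rule pencil_eigenvector[OF n g C(1) False, of "\<lambda>_. 1"])
          (use C(2) in \<open>auto simp: orthonormal_eq_diagonal_on\<close>)
      have "0 < Re (n v v)" using v C less.prems(2) by (auto simp: pos_on_def)
      then obtain c where c: "c \<noteq> 0" "orthonormal n {c *s v}"
        using orthonormal_extend[OF n, of "{}" v] by (auto simp: orthonormal_def)
      define v' where "v' = c *s v"
      have v'U: "v' \<in> U" unfolding v'_def C(3) using v(1) by (rule span_scale)
      have n1: "n v' v' = 1" using c(2) unfolding orthonormal_def v'_def by simp
      have gv': "g w v' = l * n w v'" if "w \<in> U" for w
        using v(3)[of w] that C(3) unfolding v'_def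
        by (simp add: hermitian_formD[OF n] hermitian_formD[OF g])
      define W where "W = {w\<in>U. n v' w = 0}"
      have U: "subspace U" by (rule fin_subspace_imp_subspace[OF less.prems(1)])
      have W: "subspace W" unfolding W_def
        by (rule dim_kernel[OF less.prems(1)]) (simp_all add: hermitian_formD[OF n])
      have WU: "W \<subseteq> U" unfolding W_def by auto
      have fW: "fin_subspace W" using fin_subspace_subset[OF less.prems(1) W WU] .
      have "v' \<notin> W" using n1 unfolding W_def by simp
      then have "Suc (dim W) = dim (span (insert v' W))" using dim_span_insert[OF fW] by simp
      also have "\<dots> \<le> dim U"
        using v'U WU U by (intro dim_subset_fin[OF less.prems(1)] span_minimal) auto
      finally have "dim W < dim U" by simp
      then obtain B e where B: "finite B" "orthonormal n B" "W = span B"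
        and d: "diagonal_on g B e"
        using less.hyps[of W] fW pos_on_subset[OF less.prems(2) WU] by blast
      have BW: "b \<in> W" if "b \<in> B" for b using B(3) span_base that by auto
      have nb: "n b v' = 0" "n v' b = 0" if "b \<in> B" for b
        using BW[OF that] hermitian_form_zero_sym[OF n] unfolding W_def by auto
      \<comment> \<open>The eigenvector equation turns orthogonality for \<open>n\<close> into
        orthogonality for \<open>g\<close>, so the new basis vector does not disturb the diagonal
        shape.\<close>
      have gb: "g b v' = 0" "g v' b = 0" if "b \<in> B" for b
      proof -
        show "g b v' = 0" using gv'[of b] nb[OF that] BW[OF that] WU by auto
        then show "g v' b = 0" using hermitian_form_zero_sym[OF g] by blast
      qed
      define e' where "e' = e(v' := Re (g v' v'))"
      have v'B: "v' \<notin> B" using n1 nb by fastforce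
      have "orthonormal n (insert v' B)"
        using B(2) n1 nb unfolding orthonormal_def by fastforce
      moreover have "U = span (insert v' B)"
      proof
        show "span (insert v' B) \<subseteq> U" using v'U BW WU U by (intro span_minimal) auto
        show "U \<subseteq> span (insert v' B)"
        proof
          fix u assume u: "u \<in> U"
          have "u - n v' u *s v' \<in> W" unfolding W_def
            using u v'U U n1 by (simp add: subspace_diff subspace_scale hermitian_formD[OF n])
          then show "u \<in> span (insert v' B)" unfolding span_insert B(3) by blast
        qed
      qed
      moreover have "g u w = (if u = w then complex_of_real (e' u) else 0)"
        if "u \<in> insert v' B" "w \<in> insert v' B" for u w
        using that diagonal_onD[OF d, of u w] gb v'B hermitian_form_self[OF g, of v']
        unfolding e'_def by (auto split: if_splits)
      then have "diagonal_on g (insert v' B) e'" unfolding diagonal_on_def by blast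
      ultimately show ?thesis using B(1) by blast
    qed
  qed
  then show ?thesis using that by blast
qed

lemma pos_on_diagonal_span:
  assumes n: "hermitian_form n" and g: "hermitian_form g"
    and B: "finite B" "orthonormal n B"
    and d: "diagonal_on g B e"
    and e: "\<And>b. b \<in> B \<Longrightarrow> 0 < e b"
  shows "pos_on g (span B)"
  unfolding pos_on_def
proof (intro ballI impI)
  fix u assume u: "u \<in> span B" "u \<noteq> 0"
  have *: "Re (g u u) = (\<Sum>b\<in>B. e b * (cmod (n b u))\<^sup>2)"
    by (rule form_diagonal_expansion[OF n g B d u(1)])
  have "\<exists>b\<in>B. n b u \<noteq> 0"
  proof (rule ccontr)
    assume "\<not> ?thesis"
    then have "u = 0" using orthonormal_expansion[OF n B u(1)] by simp
    then show False using u(2) by simp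
  qed
  then obtain b where b: "b \<in> B" "n b u \<noteq> 0" by blast
  have "0 < (\<Sum>b\<in>B. e b * (cmod (n b u))\<^sup>2)"
    by (rule sum_pos2[OF B(1) b(1)]) (use b e in \<open>auto simp: less_imp_le\<close>)
  then show "0 < Re (g u u)" using * by simp
qed

text \<open>Counterpart of \<open>pos_on_diagonal_span\<close> for the remaining basis vectors; zero
  entries are allowed, hence only a weak inequality.\<close>

lemma nonpos_diagonal_span:
  assumes n: "hermitian_form n" and g: "hermitian_form g"
    and B: "finite B" "orthonormal n B"
    and d: "diagonal_on g B e"
    and e: "\<And>b. b \<in> B \<Longrightarrow> e b \<le> 0" and u: "u \<in> span B"
  shows "Re (g u u) \<le> 0"
  unfolding form_diagonal_expansion[OF n g B d u]
  by (rule sum_nonpos) (simp add: e mult_nonpos_nonneg)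

section \<open>Stability of definiteness\<close>

text \<open>Diagonalize \<open>g\<close> relative to \<open>f\<close>: the sum of the absolute
  eigenvalues dominates each of them and also makes sense for the zero subspace.\<close>

lemma pos_on_bound:
  assumes f: "hermitian_form f" and g: "hermitian_form g" and P: "fin_subspace P" "pos_on f P"
  obtains C where "0 \<le> C" "\<And>q. q \<in> P \<Longrightarrow> \<bar>Re (g q q)\<bar> \<le> C * Re (f q q)"
proof -
  obtain B e where B: "finite B" "orthonormal f B" "P = span B"
    and d: "diagonal_on g B e"
    using simultaneous_diagonalization[OF f g P] by blast
  define C where "C = (\<Sum>b\<in>B. \<bar>e b\<bar>)"
  have "\<bar>Re (g q q)\<bar> \<le> C * Re (f q q)" if q: "q \<in> P" for q
  proof -
    have qB: "q \<in> span B" using q B(3) by simp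
    have "\<bar>Re (g q q)\<bar> \<le> (\<Sum>b\<in>B. \<bar>e b * (cmod (f b q))\<^sup>2\<bar>)"
      unfolding form_diagonal_expansion[OF f g B(1,2) d qB] by (rule sum_abs)
    also have "\<dots> \<le> (\<Sum>b\<in>B. C * (cmod (f b q))\<^sup>2)"
    proof (intro sum_mono)
      fix b assume "b \<in> B"
      then have "\<bar>e b\<bar> \<le> C" unfolding C_def using B(1) by (intro member_le_sum) auto
      then show "\<bar>e b * (cmod (f b q))\<^sup>2\<bar> \<le> C * (cmod (f b q))\<^sup>2"
        by (simp add: abs_mult mult_right_mono)
    qed
    also have "\<dots> = C * Re (f q q)"
      unfolding norm_expansion[OF f B(1,2) qB] by (simp add: sum_distrib_left)
    finally show ?thesis .
  qed
  moreover have "0 \<le> C" unfolding C_def by (simp add: sum_nonneg)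
  ultimately show ?thesis using that by blast
qed

text \<open>Positivity on a fixed finite-dimensional subspace is an open condition. Three directions
  are perturbed at once because \<open>boundary_shift\<close> moves both pencil parameters and the
  shift.\<close>

lemma pos_on_perturb3:
  assumes f: "hermitian_form f" and g: "hermitian_form g1" "hermitian_form g2" "hermitian_form g3"
    and P: "fin_subspace P" "pos_on f P"
  obtains d where "0 < d"
    "\<And>a b c. \<bar>a\<bar> < d \<Longrightarrow> \<bar>b\<bar> < d \<Longrightarrow> \<bar>c\<bar> < d \<Longrightarrow>
      pos_on (\<lambda>u w. f u w + (of_real a * g1 u w + of_real b * g2 u w + of_real c * g3 u w)) P"
proof -
  obtain C1 where C1: "0 \<le> C1" "\<And>q. q \<in> P \<Longrightarrow> \<bar>Re (g1 q q)\<bar> \<le> C1 * Re (f q q)"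
    using pos_on_bound[OF f g(1) P] by blast
  obtain C2 where C2: "0 \<le> C2" "\<And>q. q \<in> P \<Longrightarrow> \<bar>Re (g2 q q)\<bar> \<le> C2 * Re (f q q)"
    using pos_on_bound[OF f g(2) P] by blast
  obtain C3 where C3: "0 \<le> C3" "\<And>q. q \<in> P \<Longrightarrow> \<bar>Re (g3 q q)\<bar> \<le> C3 * Re (f q q)"
    using pos_on_bound[OF f g(3) P] by blast
  \<comment> \<open>The summand 1 makes \<open>D\<close> positive and leaves slack: the perturbation
    is at most (D - 1) / D times the value of \<open>f\<close>.\<close>
  define D where "D = 1 + C1 + C2 + C3"
  have D: "D > 0" using C1 C2 C3 unfolding D_def by simp
  show ?thesis
  proof (rule that[of "1 / D"])
    show "0 < 1 / D" using D by simp
    fix a b c :: real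
    assume small: "\<bar>a\<bar> < 1 / D" "\<bar>b\<bar> < 1 / D" "\<bar>c\<bar> < 1 / D"
    show "pos_on (\<lambda>u w. f u w + (of_real a * g1 u w + of_real b * g2 u w + of_real c * g3 u w)) P"
      unfolding pos_on_def
    proof (intro ballI impI)
      fix q assume q: "q \<in> P" "q \<noteq> 0"
      define F where "F = Re (f q q)"
      have F: "F > 0" using P(2) q unfolding pos_on_def F_def by blast
      have *: "\<bar>x * y\<bar> \<le> 1 / D * (C * F)" if "\<bar>x\<bar> < 1 / D" "\<bar>y\<bar> \<le> C * F" for x y C
        unfolding abs_mult using that D by (intro mult_mono) auto
      have "\<bar>a * Re (g1 q q)\<bar> \<le> 1 / D * (C1 * F)" "\<bar>b * Re (g2 q q)\<bar> \<le> 1 / D * (C2 * F)"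
        "\<bar>c * Re (g3 q q)\<bar> \<le> 1 / D * (C3 * F)"
        using * small C1(2)[OF q(1)] C2(2)[OF q(1)] C3(2)[OF q(1)] unfolding F_def by blast+
      then have "\<bar>a * Re (g1 q q) + b * Re (g2 q q) + c * Re (g3 q q)\<bar>
          \<le> 1 / D * (C1 * F) + 1 / D * (C2 * F) + 1 / D * (C3 * F)" by linarith
      also have "\<dots> = (D - 1) * F / D" unfolding D_def by (simp add: add_divide_distrib algebra_simps)
      also have "\<dots> < F" using F D by (simp add: field_simps)
      finally show "0 < Re (f q q + (of_real a * g1 q q + of_real b * g2 q q + of_real c * g3 q q))"
        unfolding F_def by simp
    qed
  qed
qed

lemma pos_on_perturb:
  assumes "hermitian_form f" and "hermitian_form g" and "fin_subspace P" "pos_on f P"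
  obtains d where "0 < d" "\<And>a. \<bar>a\<bar> < d \<Longrightarrow> pos_on (\<lambda>u w. f u w + of_real a * g u w) P"
proof -
  obtain d where d: "0 < d" "\<And>a b c. \<bar>a\<bar> < d \<Longrightarrow> \<bar>b\<bar> < d \<Longrightarrow> \<bar>c\<bar> < d \<Longrightarrow>
      pos_on (\<lambda>u w. f u w + (of_real a * g u w + of_real b * g u w + of_real c * g u w)) P"
    using pos_on_perturb3[OF assms(1,2,2,2) assms(3,4)] by blast
  show ?thesis using that[OF d(1)] d(2)[of _ 0 0] d(1) by simp
qed

text \<open>Along the real line u + t w the form is a quadratic in t whose outer coefficients have
  opposite signs, so it has a real root. The vector there is nonzero, as otherwise \<open>u\<close>
  would be a real multiple of \<open>w\<close> and f(u,u) would not be positive.\<close>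

lemma isotropic_combination:
  assumes f: "hermitian_form f" and u: "0 < Re (f u u)" and w: "Re (f w w) < 0"
  obtains c where "f (u + c *s w) (u + c *s w) = 0" "u + c *s w \<noteq> 0"
proof -
  define p q r where "p = Re (f w w)" and "q = 2 * Re (f u w)" and "r = Re (f u u)"
  have "p * r \<le> 0" using u w unfolding p_def r_def by (simp add: mult_nonpos_nonneg)
  then have "0 \<le> discrim p q r" unfolding discrim_def using zero_le_power2[of q] by linarith
  then obtain t where t: "p * t\<^sup>2 + q * t + r = 0"
    using discriminant_nonneg_ex[of p q r] w unfolding p_def by auto
  have Re: "Re (f (u + of_real t *s w) (u + of_real t *s w)) = p * t\<^sup>2 + q * t + r"
    using hermitian_form_cnj[OF f, of w u]
    by (simp add: hermitian_formD[OF f] p_def q_def r_def power2_eq_square algebra_simps)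
  show ?thesis
  proof (rule that[of "of_real t"])
    show "f (u + of_real t *s w) (u + of_real t *s w) = 0"
      using hermitian_form_self[OF f, of "u + of_real t *s w"] Re t by simp
    show "u + of_real t *s w \<noteq> 0"
    proof
      assume "u + of_real t *s w = 0"
      then have "u = - (of_real t *s w)" by (simp add: eq_neg_iff_add_eq_0)
      then have "Re (f u u) = t * (t * Re (f w w))" by (simp add: hermitian_formD[OF f])
      also have "\<dots> \<le> 0" using w by (simp add: mult_nonneg_nonpos flip: mult.assoc)
      finally show False using u by simp
    qed
  qed
qed

lemma diagonal_on_apply:
  assumes n: "hermitian_form n" and f: "hermitian_form f" and B: "finite B" "orthonormal n B"
    and d: "diagonal_on f B e" and b: "b \<in> B" and w: "w \<in> span B"
  shows "f b w = of_real (e b) * n b w"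
proof -
  define c where "c b = n b w" for b
  have "f b w = f b (\<Sum>b'\<in>B. c b' *s b')"
    using orthonormal_expansion[OF n B w] unfolding c_def by simp
  also have "\<dots> = (\<Sum>b'\<in>B. c b' * f b b')"
    by (simp only: hermitian_form_sum[OF f] hermitian_formD[OF f])
  also have "\<dots> = (\<Sum>b'\<in>B. if b' = b then of_real (e b) * c b else 0)"
    using diagonal_onD[OF d b] by (intro sum.cong) auto
  finally show ?thesis using b B(1) unfolding c_def by simp
qed

section \<open>Isotropic subspaces of a Hermitian pencil\<close>

text \<open>If \<open>g\<close> had no isotropic vector in the radical \<open>E\<close> of
  \<open>f\<close>, it would be definite on \<open>E\<close>. Then f + a g, for a small
  \<open>a\<close> of the right sign, would be negative on the whole nonpositive part
  \<open>Q\<close> of \<open>f\<close>: on \<open>E\<close> by the term a g, on a complement of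
  \<open>E\<close> in \<open>Q\<close> by openness. But \<open>Q\<close> has dimension greater than
  dim U - k, as \<open>f\<close> has fewer than k positive eigenvalues.\<close>

lemma isotropic_in_radical:
  assumes n: "hermitian_form n" and f: "hermitian_form f" and g: "hermitian_form g"
    and U: "fin_subspace U" and nU: "pos_on n U"
    and neg: "\<And>a Q. subspace Q \<Longrightarrow> Q \<subseteq> U \<Longrightarrow> neg_on (\<lambda>u w. f u w + of_real a * g u w) Q \<Longrightarrow>
      dim Q + k \<le> dim U"
    and pos: "\<And>P. subspace P \<Longrightarrow> P \<subseteq> U \<Longrightarrow> pos_on f P \<Longrightarrow> dim P < k"
  obtains v where "v \<in> U" "v \<noteq> 0" "g v v = 0" "\<forall>w\<in>U. f v w = 0"
proof (rule ccontr)
  assume "\<not> thesis"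
  with that have noiso: "g v v \<noteq> 0" if "v \<in> U" "v \<noteq> 0" "\<forall>w\<in>U. f v w = 0" for v
    using that by blast
  have sU: "subspace U" by (rule fin_subspace_imp_subspace[OF U])
  obtain B e where B: "finite B" "orthonormal n B" "U = span B" and d: "diagonal_on f B e"
    using simultaneous_diagonalization[OF n f U nU] by blast
  have fb: "f b w = of_real (e b) * n b w" if "b \<in> B" "w \<in> U" for b w
    using diagonal_on_apply[OF n f B(1,2) d] that B(3) by simp
  define Bp where "Bp = {b\<in>B. 0 < e b}"
  define Bn where "Bn = {b\<in>B. e b \<le> 0}"
  have Bpn: "Bp \<subseteq> B" "Bn \<subseteq> B" "finite Bp" "finite Bn" "Bp \<union> Bn = B" "Bp \<inter> Bn = {}"
    using B(1) unfolding Bp_def Bn_def by auto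
  have on: "orthonormal n Bp" "orthonormal n Bn"
    using B(2) Bpn(1,2) unfolding orthonormal_def by blast+
  have dg: "diagonal_on f Bp e" "diagonal_on f Bn e"
    using d Bpn(1,2) unfolding diagonal_on_def by blast+
  define Q where "Q = span Bn"
  have QU: "Q \<subseteq> U" unfolding Q_def B(3) by (rule span_mono[OF Bpn(2)])
  have sQ: "subspace Q" unfolding Q_def by simp
  have "dim (span Bp) < k"
    using pos_on_diagonal_span[OF n f Bpn(3) on(1) dg(1)] span_mono[OF Bpn(1)]
    by (intro pos) (auto simp: Bp_def B(3))
  then have "card Bp < k" using orthonormal_card[OF n Bpn(3) on(1)] by simp
  moreover have "card Bp + card Bn = dim U"
    using orthonormal_card[OF n B(1,2)] B(3) card_Un_disjoint[OF Bpn(3,4,6)] Bpn(5) by simp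
  moreover have "dim Q = card Bn" using orthonormal_card[OF n Bpn(4) on(2)] unfolding Q_def by simp
  ultimately have dQ: "dim U < dim Q + k" by simp
  define E where "E = {u\<in>U. \<forall>w\<in>U. f u w = 0}"
  have EU: "E \<subseteq> U" unfolding E_def by auto
  have sE: "subspace E" unfolding E_def using sU
    by (auto simp: subspace_def hermitian_formD[OF f])
  have fE: "fin_subspace E" using fin_subspace_subset[OF U sE EU] .
  have EQ: "E \<subseteq> Q"
  proof
    fix u assume u: "u \<in> E"
    have "n b u *s b \<in> span Bn" if "b \<in> B" for b
    proof (cases "e b = 0")
      case True
      then show ?thesis using that unfolding Bn_def by (intro span_scale span_base) auto
    next
      case False
      have "f b u = 0" using u EU that hermitian_form_zero_sym[OF f, of b u] span_base[OF that] B(3)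
        unfolding E_def by auto
      then have "n b u = 0" using fb[OF that, of u] u EU False by auto
      then show ?thesis by (simp add: span_zero)
    qed
    then have "(\<Sum>b\<in>B. n b u *s b) \<in> span Bn" by (rule span_sum)
    moreover have "u = (\<Sum>b\<in>B. n b u *s b)"
      using orthonormal_expansion[OF n B(1,2)] u EU B(3) by blast
    ultimately show "u \<in> Q" unfolding Q_def by metis
  qed
  \<comment> \<open>For a semidefinite form null vectors are radical: in a vanishing sum of
    nonpositive terms only coordinates with diagonal entry 0 survive.\<close>
  have null: "q \<in> E" if q: "q \<in> Q" and z: "Re (f q q) = 0" for q
  proof -
    have qs: "q \<in> span Bn" using q unfolding Q_def .
    have "(\<Sum>b\<in>Bn. - (e b * (cmod (n b q))\<^sup>2)) = 0"
      using form_diagonal_expansion[OF n f Bpn(4) on(2) dg(2) qs] z by (simp add: sum_negf)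
    moreover have "0 \<le> - (e b * (cmod (n b q))\<^sup>2)" if "b \<in> Bn" for b
      using that unfolding Bn_def by (simp add: mult_nonpos_nonneg)
    ultimately have 0: "e b * (cmod (n b q))\<^sup>2 = 0" if "b \<in> Bn" for b
      using that Bpn(4) by (simp add: sum_nonneg_eq_0_iff)
    have "f q w = 0" if w: "w \<in> U" for w
    proof -
      have "f q w = f (\<Sum>b\<in>Bn. n b q *s b) w"
        using arg_cong[OF orthonormal_expansion[OF n Bpn(4) on(2) qs], of "\<lambda>z. f z w"] .
      also have "\<dots> = (\<Sum>b\<in>Bn. cnj (n b q) * f b w)"
        by (simp only: hermitian_form_sum[OF f] hermitian_formD[OF f])
      also have "\<dots> = 0"
      proof (rule sum.neutral, intro ballI)
        fix b assume b: "b \<in> Bn"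
        then have "b \<in> B" using Bpn(2) by auto
        then show "cnj (n b q) * f b w = 0" using fb[OF _ w] 0[OF b] by auto
      qed
      finally show ?thesis .
    qed
    then show ?thesis unfolding E_def using q QU by auto
  qed
  have real: "Re (g u u) \<noteq> 0" if "u \<in> E" "u \<noteq> 0" for u
    using noiso[of u] that hermitian_form_self[OF g, of u] unfolding E_def by auto
  \<comment> \<open>Two vectors of \<open>E\<close> with opposite signs of \<open>g\<close> would
    combine to an isotropic one, so \<open>g\<close> has a constant sign on \<open>E\<close>;
    \<open>s\<close> is the opposite sign.\<close>
  obtain s :: real where s: "s = 1 \<or> s = -1" "\<And>u. u \<in> E \<Longrightarrow> u \<noteq> 0 \<Longrightarrow> s * Re (g u u) < 0"
  proof (cases "\<exists>u\<in>E. 0 < Re (g u u)")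
    case False
    then have "1 * Re (g u u) < 0" if "u \<in> E" "u \<noteq> 0" for u using real[OF that] that by force
    then show ?thesis using that[of 1] by blast
  next
    case True
    then obtain u where u: "u \<in> E" "0 < Re (g u u)" by auto
    have "0 < Re (g w w)" if w: "w \<in> E" "w \<noteq> 0" for w
    proof (rule ccontr)
      assume "\<not> ?thesis"
      then have "Re (g w w) < 0" using real[OF w] by simp
      then obtain c where c: "g (u + c *s w) (u + c *s w) = 0" "u + c *s w \<noteq> 0"
        using isotropic_combination[OF g u(2)] by blast
      have "u + c *s w \<in> E" using u(1) w(1) sE by (simp add: subspace_add subspace_scale)
      then show False using real[OF _ c(2)] c(1) by simp
    qed
    then show ?thesis using that[of "-1"] by auto
  qed
  \<comment> \<open>The multiple of \<open>g\<close> that is positive on \<open>E\<close>, as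
    projection onto \<open>E\<close> requires; the zero summand only gives it the shape of
    \<open>hermitian_form_lincomb\<close>.\<close>
  define g' where "g' = (\<lambda>u w. of_real (- s) * g u w + of_real 0 * g u w)"
  have g': "hermitian_form g'" unfolding g'_def by (rule hermitian_form_lincomb[OF g g])
  have g'E: "pos_on g' E" unfolding pos_on_def g'_def using s(2) by simp
  \<comment> \<open>The complement is taken orthogonal for \<open>g\<close>, not for
    \<open>n\<close>, so that the cross terms of \<open>g\<close> vanish; those of \<open>f\<close>
    vanish because \<open>E\<close> is its radical. \<open>Q'\<close> meets \<open>E\<close> only in
    0, so \<open>f\<close> is strictly negative on it.\<close>
  define Q' where "Q' = {q\<in>Q. \<forall>u\<in>E. g u q = 0}"
  have sQ': "subspace Q'" unfolding Q'_def using sQ by (auto simp: subspace_def hermitian_formD[OF g])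
  have fQ': "fin_subspace Q'" using fin_subspace_subset[OF U sQ'] QU unfolding Q'_def by auto
  have negQ': "neg_on f Q'"
    unfolding pos_on_def
  proof (intro ballI impI)
    fix q assume q: "q \<in> Q'" "q \<noteq> 0"
    have "Re (f q q) \<le> 0"
      using nonpos_diagonal_span[OF n f Bpn(4) on(2) dg(2), of q] q(1)
      unfolding Q'_def Q_def Bn_def by auto
    moreover have "Re (f q q) \<noteq> 0"
    proof
      assume "Re (f q q) = 0"
      then have qE: "q \<in> E" using null q(1) unfolding Q'_def by auto
      then have "g q q = 0" using q(1) unfolding Q'_def by auto
      then show False using real[OF qE q(2)] by simp
    qed
    ultimately show "0 < Re (- f q q)" by simp
  qed
  obtain t where t: "0 < t" "\<And>a. \<bar>a\<bar> < t \<Longrightarrow> pos_on (\<lambda>u w. - f u w + of_real a * g u w) Q'"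
    using pos_on_perturb[OF hermitian_form_uminus[OF f] g fQ' negQ'] by blast
  \<comment> \<open>The sign \<open>s\<close> makes a g negative on \<open>E\<close>; the size t / 2
    stays inside the range where \<open>f\<close> dominates on \<open>Q'\<close>.\<close>
  define a where "a = s * (t / 2)"
  have "\<bar>- a\<bar> < t" using t(1) s(1) unfolding a_def by auto
  from t(2)[OF this] have negr: "Re (f r r) + a * Re (g r r) < 0" if "r \<in> Q'" "r \<noteq> 0" for r
    using pos_onD[OF _ that] by fastforce
  have "neg_on (\<lambda>u w. f u w + of_real a * g u w) Q"
    unfolding pos_on_def
  proof (intro ballI impI)
    fix q assume q: "q \<in> Q" "q \<noteq> 0"
    obtain e where e: "e \<in> E" "\<And>w. w \<in> E \<Longrightarrow> g' w (q - e) = 0"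
      using orthogonal_projection[OF g' fE g'E] by blast
    define r where "r = q - e"
    have ger: "g w r = 0" if "w \<in> E" for w using e(2)[OF that] s(1) unfolding g'_def r_def by auto
    have "r \<in> Q" unfolding r_def using q(1) e(1) EQ sQ by (auto intro: subspace_diff)
    then have rQ': "r \<in> Q'" unfolding Q'_def using ger by auto
    have qe: "q = e + r" unfolding r_def by simp
    have "f e w = 0" "f w e = 0" if "w \<in> U" for w
      using e(1) that hermitian_form_zero_sym[OF f, of e w] unfolding E_def by auto
    moreover have "r \<in> U" "e \<in> U" using \<open>r \<in> Q\<close> QU e(1) EU by auto
    ultimately have "f q q = f r r" unfolding qe by (simp add: hermitian_formD[OF f])
    moreover have "g q q = g e e + g r r" unfolding qe
      using ger[OF e(1)] hermitian_form_zero_sym[OF g, of e r] by (simp add: hermitian_formD[OF g])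
    ultimately have eq: "Re (f q q + of_real a * g q q)
        = a * Re (g e e) + (Re (f r r) + a * Re (g r r))" by (simp add: algebra_simps)
    have 1: "a * Re (g e e) < 0" if "e \<noteq> 0"
      using mult_pos_neg[OF t(1) s(2)[OF e(1) that]] unfolding a_def by (simp add: algebra_simps)
    have 2: "e = 0 \<Longrightarrow> a * Re (g e e) = 0" "r = 0 \<Longrightarrow> Re (f r r) + a * Re (g r r) = 0"
      by (simp_all add: hermitian_formD[OF f] hermitian_formD[OF g])
    have "e \<noteq> 0 \<or> r \<noteq> 0" using q(2) qe by auto
    then have "a * Re (g e e) + (Re (f r r) + a * Re (g r r)) < 0"
      using 1 2 negr[OF rQ'] by fastforce
    then show "0 < Re (- (f q q + of_real a * g q q))" using eq by simp
  qed
  from neg[OF sQ QU this] dQ show False by simp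
qed

section \<open>The index condition and reducing vectors\<close>

abbreviation pencil :: "('a \<Rightarrow> 'a \<Rightarrow> complex) \<Rightarrow> ('a \<Rightarrow> 'a \<Rightarrow> complex) \<Rightarrow> real \<Rightarrow> real \<Rightarrow> 'a \<Rightarrow> 'a \<Rightarrow> complex"
  where "pencil h g x y \<equiv> \<lambda>u w. of_real x * h u w + of_real y * g u w"

text \<open>
  Every form in the pencil has negative index at most \<open>dim U - k\<close>, written without the truncated
  subtraction.
\<close>

definition index_condition where
  "index_condition h g U k \<longleftrightarrow>
     (\<forall>x y Q. subspace Q \<longrightarrow> Q \<subseteq> U \<longrightarrow> neg_on (pencil h g x y) Q \<longrightarrow> dim Q + k \<le> dim U)"

lemma index_conditionD:
  "index_condition h g U k \<Longrightarrow> subspace Q \<Longrightarrow> Q \<subseteq> U \<Longrightarrow> neg_on (pencil h g x y) Q \<Longrightarrow>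
    dim Q + k \<le> dim U"
  unfolding index_condition_def by blast

text \<open>The coefficients of the dependence are complex, because a nonreal eigenvalue of the
  pencil provides one of the two sources of such vectors.\<close>

definition reducing_vector where
  "reducing_vector h g U v \<longleftrightarrow> v \<in> U \<and> v \<noteq> 0 \<and> h v v = 0 \<and> g v v = 0 \<and>
     (\<exists>a b. (a, b) \<noteq> (0, 0) \<and> (\<forall>w\<in>U. a * h v w + b * g v w = (0 :: complex)))"

text \<open>Rotating (x, y) infinitesimally moves it in the direction (- y, x), and the perturbed
  form again belongs to the pencil. So \<open>isotropic_in_radical\<close> applies with this
  perpendicular form, and membership in the radical is the required dependence.\<close>

lemma reducing_vector_of_degenerate:
  assumes n: "hermitian_form n" and h: "hermitian_form h" and g: "hermitian_form g"
    and U: "fin_subspace U" and nU: "pos_on n U" and ic: "index_condition h g U k"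
    and xy: "(x, y) \<noteq> (0, 0)"
    and pos: "\<And>P. subspace P \<Longrightarrow> P \<subseteq> U \<Longrightarrow> pos_on (pencil h g x y) P \<Longrightarrow> dim P < k"
  obtains v where "reducing_vector h g U v"
proof -
  obtain v where v: "v \<in> U" "v \<noteq> 0" "pencil h g (- y) x v v = 0"
    "\<forall>w\<in>U. pencil h g x y v w = 0"
  proof (rule isotropic_in_radical[OF n hermitian_form_lincomb[OF h g]
        hermitian_form_lincomb[OF h g] U nU _ pos])
    fix a Q assume "subspace Q" "Q \<subseteq> U"
      and *: "neg_on (\<lambda>u w. pencil h g x y u w + of_real a * pencil h g (- y) x u w) Q"
    have "(\<lambda>u w. pencil h g x y u w + of_real a * pencil h g (- y) x u w)
        = pencil h g (x - a * y) (y + a * x)"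
      by (intro ext) (simp add: algebra_simps)
    with * have "neg_on (pencil h g (x - a * y) (y + a * x)) Q" by metis
    then show "dim Q + k \<le> dim U" using index_conditionD[OF ic] \<open>subspace Q\<close> \<open>Q \<subseteq> U\<close> by blast
  qed blast
  have 1: "of_real x * h v v + of_real y * g v v = 0" using v(1,4) by blast
  have 2: "of_real x * g v v - of_real y * h v v = 0" using v(3) by simp
  \<comment> \<open>Both the form at (x, y) and the perpendicular one vanish at \<open>v\<close>;
    the system for h(v,v) and g(v,v) has determinant \<open>x\<^sup>2 + y\<^sup>2\<close>.\<close>
  have "of_real (x\<^sup>2 + y\<^sup>2) * h v v = of_real x * (of_real x * h v v + of_real y * g v v)
      - of_real y * (of_real x * g v v - of_real y * h v v)"
    by (simp add: power2_eq_square algebra_simps)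
  then have "of_real (x\<^sup>2 + y\<^sup>2) * h v v = 0" unfolding 1 2 by simp
  moreover have "of_real (x\<^sup>2 + y\<^sup>2) * g v v = of_real y * (of_real x * h v v + of_real y * g v v)
      + of_real x * (of_real x * g v v - of_real y * h v v)"
    by (simp add: power2_eq_square algebra_simps)
  then have "of_real (x\<^sup>2 + y\<^sup>2) * g v v = 0" unfolding 1 2 by simp
  moreover have "x\<^sup>2 + y\<^sup>2 \<noteq> 0" using xy by (simp add: sum_power2_eq_zero_iff)
  ultimately have "h v v = 0" "g v v = 0" by (metis mult_eq_0_iff of_real_eq_0_iff)+
  then have "reducing_vector h g U v"
    unfolding reducing_vector_def using v(1,2,4) xy
    by (intro conjI exI[of _ "of_real x"] exI[of _ "of_real y"]) auto
  then show ?thesis using that by blast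
qed

lemma in_span_insert_subspace:
  assumes "subspace Q" "x \<in> span (insert z Q)"
  obtains c where "x - c *s z \<in> Q"
proof -
  obtain c where "x - c *s z \<in> span Q" using assms(2) unfolding span_insert by blast
  also have "span Q = Q" using assms(1) by (simp only: span_eq_iff)
  finally show ?thesis by (rule that)
qed

text \<open>After \<open>u\<close> is made orthogonal to \<open>Q\<close>, it still pairs with the
  isotropic vector \<open>v\<close>. The value of the form at u' + c v is then affine in
  \<open>c\<close> and can be made negative, without losing orthogonality to
  \<open>Q\<close>.\<close>

lemma extend_negative_subspace:
  assumes f: "hermitian_form f" and U: "fin_subspace U" and Q: "subspace Q" "Q \<subseteq> U" "neg_on f Q"
    and v: "v \<in> U" "f v v = 0" "\<And>q. q \<in> Q \<Longrightarrow> f v q = 0" and u: "u \<in> U" "f v u \<noteq> 0"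
  obtains Q' where "subspace Q'" "Q' \<subseteq> U" "neg_on f Q'" "dim Q' = Suc (dim Q)"
proof -
  have sU: "subspace U" by (rule fin_subspace_imp_subspace[OF U])
  have fQ: "fin_subspace Q" by (rule fin_subspace_subset[OF U Q(1,2)])
  obtain e where e: "e \<in> Q" "\<And>w. w \<in> Q \<Longrightarrow> - f w (u - e) = 0"
    using orthogonal_projection[OF hermitian_form_uminus[OF f] fQ Q(3)] by blast
  define u' where "u' = u - e"
  define \<alpha> where "\<alpha> = f v u'"
  have \<alpha>: "\<alpha> \<noteq> 0" using u(2) v(3)[OF e(1)] unfolding \<alpha>_def u'_def by (simp add: hermitian_formD[OF f])
  define r where "r = Re (f u' u')"
  \<comment> \<open>Chosen so that f(z,z) becomes r - 2 (|r| + 1), which is negative for either sign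
    of r.\<close>
  define t where "t = (\<bar>r\<bar> + 1) / (cmod \<alpha>)\<^sup>2"
  define c where "c = - of_real t * \<alpha>"
  define z where "z = u' + c *s v"
  have "f u' v = cnj \<alpha>" unfolding \<alpha>_def by (rule hermitian_form_cnj[OF f])
  then have "f z z = f u' u' + (c * cnj \<alpha> + cnj c * \<alpha>)"
    unfolding z_def using v(2) by (simp add: hermitian_formD[OF f] \<alpha>_def)
  also have "c * cnj \<alpha> + cnj c * \<alpha> = of_real (- 2 * t * (cmod \<alpha>)\<^sup>2)"
    unfolding c_def by (simp add: complex_norm_square del: of_real_power)
  finally have "Re (f z z) = r - 2 * t * (cmod \<alpha>)\<^sup>2" unfolding r_def by simp
  also have "\<dots> = r - 2 * (\<bar>r\<bar> + 1)" using \<alpha> unfolding t_def by simp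
  also have "r - 2 * (\<bar>r\<bar> + 1) < 0" by (cases "0 \<le> r") simp_all
  finally have zz: "Re (f z z) < 0" .
  have qz: "f q z = 0" "f z q = 0" if "q \<in> Q" for q
  proof -
    have "f q v = 0" using v(3)[OF that] hermitian_form_zero_sym[OF f] by blast
    then show "f q z = 0" using e(2)[OF that] unfolding z_def u'_def by (simp add: hermitian_formD[OF f])
    then show "f z q = 0" using hermitian_form_zero_sym[OF f] by blast
  qed
  have zU: "z \<in> U" unfolding z_def u'_def
    using u(1) v(1) e(1) Q(2) sU by (auto intro!: subspace_add subspace_diff subspace_scale)
  have zQ: "z \<notin> Q" using qz(1)[of z] zz by auto
  show ?thesis
  proof (rule that[of "span (insert z Q)"])
    show "span (insert z Q) \<subseteq> U" using zU Q(2) sU by (intro span_minimal) auto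
    show "dim (span (insert z Q)) = Suc (dim Q)" by (rule dim_span_insert[OF fQ zQ])
    show "neg_on f (span (insert z Q))" unfolding pos_on_def
    proof (intro ballI impI)
      fix x assume x: "x \<in> span (insert z Q)" "x \<noteq> 0"
      obtain d where d: "x - d *s z \<in> Q" using in_span_insert_subspace[OF Q(1) x(1)] .
      define q where "q = x - d *s z"
      have q: "q \<in> Q" using d unfolding q_def .
      have xq: "x = q + d *s z" unfolding q_def by simp
      have "f x x = f q q + cnj d * d * f z z" unfolding xq
        using qz[OF q] by (simp add: hermitian_formD[OF f] algebra_simps)
      also have "cnj d * d = of_real ((cmod d)\<^sup>2)"
        by (simp add: complex_norm_square mult.commute del: of_real_power)
      finally have fx: "Re (f x x) = Re (f q q) + (cmod d)\<^sup>2 * Re (f z z)" by simp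
      have 1: "Re (f q q) < 0" if "q \<noteq> 0" using Q(3) q that unfolding pos_on_def by auto
      have 2: "(cmod d)\<^sup>2 * Re (f z z) < 0" if "d \<noteq> 0" using zz that by (simp add: mult_pos_neg)
      have "q \<noteq> 0 \<or> d \<noteq> 0" using x(2) xq by auto
      then have "Re (f x x) < 0" unfolding fx
        using 1 2 by (cases "q = 0"; cases "d = 0") (auto simp: hermitian_formD[OF f])
      then show "0 < Re (- f x x)" by simp
    qed
  qed simp
qed

text \<open>\<open>W\<close> has codimension at most two in \<open>U\<close>. A negative
  \<open>Q\<close> inside \<open>W\<close> gains one dimension in \<open>U\<close> by
  \<open>extend_negative_subspace\<close>, so dim Q + 1 + (k + 1) is at most dim U, hence at most
  dim W + 2.\<close>

lemma reducing_vector_step: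
  assumes n: "hermitian_form n" and h: "hermitian_form h" and g: "hermitian_form g"
    and U: "fin_subspace U" and nU: "pos_on n U" and ic: "index_condition h g U (Suc k)"
    and v: "reducing_vector h g U v"
  obtains W where "subspace W" "W \<subseteq> U" "v \<notin> W" "\<And>w. w \<in> W \<Longrightarrow> h v w = 0 \<and> g v w = 0"
    "index_condition h g W k"
proof -
  obtain a b where ab: "(a, b) \<noteq> (0, 0)" "\<And>w. w \<in> U \<Longrightarrow> a * h v w + b * g v w = 0"
    using v unfolding reducing_vector_def by auto
  have vU: "v \<in> U" "v \<noteq> 0" "h v v = 0" "g v v = 0" using v unfolding reducing_vector_def by auto
  \<comment> \<open>The dependence makes one functional decide both conditions: for a = 0 it forces
    g(v,.) = 0 on \<open>U\<close>, otherwise h(v,.) is a multiple of g(v,.).\<close>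
  define \<phi> where "\<phi> = (if a = 0 then h v else g v)"
  have \<phi>0: "h v w = 0 \<and> g v w = 0 \<longleftrightarrow> \<phi> w = 0" if "w \<in> U" for w
    using ab(1) ab(2)[OF that] unfolding \<phi>_def by auto
  define W0 where "W0 = {w\<in>U. \<phi> w = 0}"
  have W0: "subspace W0" "dim U \<le> Suc (dim W0)" unfolding W0_def
    by (rule dim_kernel[OF U]; simp add: \<phi>_def hermitian_formD[OF h] hermitian_formD[OF g])+
  have W0U: "W0 \<subseteq> U" unfolding W0_def by auto
  have fW0: "fin_subspace W0" by (rule fin_subspace_subset[OF U W0(1) W0U])
  \<comment> \<open>As \<open>v\<close> lies in \<open>W0\<close>, orthogonality to \<open>v\<close>
    for the definite form \<open>n\<close> selects a complement of \<open>v\<close> there.\<close>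
  define W where "W = {w\<in>W0. n v w = 0}"
  have W: "subspace W" "dim W0 \<le> Suc (dim W)" unfolding W_def
    by (rule dim_kernel[OF fW0]; simp add: hermitian_formD[OF n])+
  have WU: "W \<subseteq> U" using W0U unfolding W_def by auto
  have hgW: "h v w = 0 \<and> g v w = 0" if "w \<in> W" for w
    using that \<phi>0[of w] unfolding W_def W0_def by auto
  have vW: "v \<notin> W" using pos_onD[OF nU vU(1,2)] unfolding W_def by auto
  have "dim Q + k \<le> dim W"
    if Q: "subspace Q" "Q \<subseteq> W" "neg_on (pencil h g x y) Q" for x y Q
  proof (cases "\<forall>w\<in>U. \<phi> w = 0")
    \<comment> \<open>If both functionals vanish on \<open>U\<close>, the codimension is at most one
      and no enlargement of \<open>Q\<close> is possible or required.\<close>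
    case True
    then have "W0 = U" unfolding W0_def by auto
    then show ?thesis using index_conditionD[OF ic Q(1) subset_trans[OF Q(2) WU] Q(3)] W(2) by simp
  next
    case False
    then obtain u where u: "u \<in> U" "\<phi> u \<noteq> 0" by auto
    have QU: "Q \<subseteq> U" using Q(2) WU by auto
    have fQ: "fin_subspace Q" by (rule fin_subspace_subset[OF U Q(1) QU])
    \<comment> \<open>The given form may pair \<open>v\<close> to 0 with \<open>u\<close>. Since
      h(v,u) or g(v,u) is nonzero, a small change of the corresponding parameter repairs this while
      \<open>Q\<close> stays negative.\<close>
    obtain x' y' where xy': "neg_on (pencil h g x' y') Q" "pencil h g x' y' v u \<noteq> 0"
    proof (cases "pencil h g x y v u = 0")
      case False
      then show ?thesis using that Q(3) by blast
    next
      case True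
      show ?thesis
      proof (cases "h v u = 0")
        case False
        obtain d where d: "0 < d"
          "\<And>c. \<bar>c\<bar> < d \<Longrightarrow> pos_on (\<lambda>u w. - pencil h g x y u w + of_real c * h u w) Q"
          using pos_on_perturb[OF hermitian_form_uminus[OF hermitian_form_lincomb[OF h g]] h fQ Q(3)]
          by blast
        have neg: "neg_on (pencil h g (x + d / 2) y) Q"
          using d(2)[of "- d / 2"] d(1) by (simp add: algebra_simps)
        have eq: "pencil h g (x + d / 2) y v u = pencil h g x y v u + of_real (d / 2) * h v u"
          by (simp only: of_real_add distrib_right add_ac)
        have "pencil h g (x + d / 2) y v u \<noteq> 0" unfolding eq True using False d(1) by simp
        then show ?thesis using that neg by blast
      next
        case h0: True
        then have False: "g v u \<noteq> 0" using \<phi>0[OF u(1)] u(2) by auto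
        obtain d where d: "0 < d"
          "\<And>c. \<bar>c\<bar> < d \<Longrightarrow> pos_on (\<lambda>u w. - pencil h g x y u w + of_real c * g u w) Q"
          using pos_on_perturb[OF hermitian_form_uminus[OF hermitian_form_lincomb[OF h g]] g fQ Q(3)]
          by blast
        have neg: "neg_on (pencil h g x (y + d / 2)) Q"
          using d(2)[of "- d / 2"] d(1) by (simp add: algebra_simps)
        have eq: "pencil h g x (y + d / 2) v u = pencil h g x y v u + of_real (d / 2) * g v u"
          by (simp only: of_real_add distrib_right add_ac)
        have "pencil h g x (y + d / 2) v u \<noteq> 0" unfolding eq True using False d(1) by simp
        then show ?thesis using that neg by blast
      qed
    qed
    obtain Q' where Q': "subspace Q'" "Q' \<subseteq> U" "neg_on (pencil h g x' y') Q'" "dim Q' = Suc (dim Q)"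
    proof (rule extend_negative_subspace[OF hermitian_form_lincomb[OF h g] U Q(1) QU xy'(1) vU(1) _ _ u(1) xy'(2)])
      show "pencil h g x' y' v v = 0" using vU by simp
      show "pencil h g x' y' v q = 0" if "q \<in> Q" for q using hgW[of q] that Q(2) by auto
    qed blast
    have "dim Q' + Suc k \<le> dim U" by (rule index_conditionD[OF ic Q'(1,2,3)])
    then show ?thesis using Q'(4) W0(2) W(2) by simp
  qed
  then have "index_condition h g W k" unfolding index_condition_def by blast
  then show ?thesis using that W(1) WU vW hgW by blast
qed

text \<open>A form with nonzero radical in dimension 2k cannot have k positive and k negative
  eigenvalues, so it or its negative has positive index below k. Without degenerate forms the
  eigenvalue cannot be real, as \<open>v\<close> would then lie in the radical of a form of the
  pencil.\<close>

lemma reducing_vector_half_dim: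
  assumes n: "hermitian_form n" and h: "hermitian_form h" and g: "hermitian_form g"
    and U: "fin_subspace U" and nU: "pos_on n U" and ic: "index_condition h g U k"
    and k: "0 < k" "dim U = 2 * k"
  obtains v where "reducing_vector h g U v"
proof (cases "\<exists>x y r. (x, y) \<noteq> (0, 0) \<and> r \<in> U \<and> r \<noteq> 0 \<and> (\<forall>w\<in>U. pencil h g x y r w = 0)")
  case True
  then obtain x y r where xy: "(x, y) \<noteq> (0, 0)" and r: "r \<in> U" "r \<noteq> 0"
    and rad: "\<And>w. w \<in> U \<Longrightarrow> pencil h g x y r w = 0" by blast
  have f: "hermitian_form (pencil h g x y)" by (rule hermitian_form_lincomb[OF h g])
  \<comment> \<open>Adjoining the radical vector to \<open>P\<close> gives a subspace of one more
    dimension on which the form is nonnegative; it would meet a large \<open>Q\<close>. Holding for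
    all pairs, the disjunction bounds all \<open>P\<close> or all \<open>Q\<close>.\<close>
  have "dim P < k \<or> dim Q < k"
    if P: "subspace P" "P \<subseteq> U" "pos_on (pencil h g x y) P"
      and Q: "subspace Q" "Q \<subseteq> U" "pos_on (pencil h g (- x) (- y)) Q" for P Q
  proof (rule ccontr)
    assume large: "\<not> ?thesis"
    have fP: "fin_subspace P" by (rule fin_subspace_subset[OF U P(1,2)])
    have "r \<notin> P" using pos_onD[OF P(3) _ r(2)] rad[OF r(1)] by auto
    then have "dim (span (insert r P)) = Suc (dim P)" by (rule dim_span_insert[OF fP])
    then have d: "dim U < dim (span (insert r P)) + dim Q" using large k(2) by simp
    have sub: "span (insert r P) \<subseteq> U"
      using r(1) P(2) fin_subspace_imp_subspace[OF U] by (intro span_minimal) auto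
    obtain w where w: "w \<in> span (insert r P)" "w \<in> Q" "w \<noteq> 0"
      using nonzero_in_Int[OF U subspace_span Q(1) sub Q(2) d] by blast
    obtain c where c: "w - c *s r \<in> P" using in_span_insert_subspace[OF P(1) w(1)] .
    define p where "p = w - c *s r"
    have wp: "w = p + c *s r" unfolding p_def by simp
    have "pencil h g x y r z = 0" "pencil h g x y z r = 0" if "z \<in> U" for z
      using rad[OF that] hermitian_form_zero_sym[OF f, of r z] by auto
    then have "pencil h g x y w w = pencil h g x y p p"
      unfolding wp using c P(2) r(1)
      by (simp only: hermitian_formD[OF f]) (auto simp: p_def)
    moreover have "0 \<le> Re (pencil h g x y p p)"
      using pos_onD[OF P(3), of p] c unfolding p_def[symmetric]
      by (cases "p = 0") (auto simp: hermitian_formD[OF h] hermitian_formD[OF g])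
    moreover have "Re (pencil h g x y w w) < 0" using pos_onD[OF Q(3) w(2,3)] by simp
    ultimately show False by simp
  qed
  then consider
      "\<And>P. subspace P \<Longrightarrow> P \<subseteq> U \<Longrightarrow> pos_on (pencil h g x y) P \<Longrightarrow> dim P < k"
    | "\<And>P. subspace P \<Longrightarrow> P \<subseteq> U \<Longrightarrow> pos_on (pencil h g (- x) (- y)) P \<Longrightarrow> dim P < k"
    by blast
  then show ?thesis
  proof cases
    case 1
    show ?thesis by (rule reducing_vector_of_degenerate[OF n h g U nU ic xy]) (use 1 that in blast)+
  next
    case 2
    have "(- x, - y) \<noteq> (0, 0)" using xy by simp
    from reducing_vector_of_degenerate[OF n h g U nU ic this] show ?thesis using 2 that by blast
  qed
next
  case False
  then have nondeg: "\<exists>w\<in>U. pencil h g x y r w \<noteq> 0" if "(x, y) \<noteq> (0, 0)" "r \<in> U" "r \<noteq> 0" for x y r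
    using that by blast
  obtain B e where B: "finite B" "orthonormal n B" "U = span B" and d: "diagonal_on h B e"
    using simultaneous_diagonalization[OF n h U nU] by blast
  have "card B = 2 * k" using orthonormal_card[OF n B(1,2)] B(3) k(2) by simp
  then have Bne: "B \<noteq> {}" using k(1) by auto
  have e: "e b \<noteq> 0" if b: "b \<in> B" for b
  proof
    assume "e b = 0"
    then have "\<forall>w\<in>U. pencil h g 1 0 b w = 0"
      using diagonal_on_apply[OF n h B(1,2) d b] B(3) by simp
    moreover have "n b b = 1" using B(2) b unfolding orthonormal_def by simp
    then have "b \<noteq> 0" using hermitian_formD(5)[OF n, of b] by auto
    ultimately show False using nondeg[of 1 0 b] b B(3) span_base by auto
  qed
  obtain l v where v: "v \<in> U" "v \<noteq> 0" "\<And>w. w \<in> U \<Longrightarrow> g w v = l * h w v"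
    using pencil_eigenvector[OF h g B(1) Bne d e] B(3) by metis
  have gv: "g v w = cnj l * h v w" if "w \<in> U" for w
    using v(3)[OF that] hermitian_form_cnj[OF g, of v w] hermitian_form_cnj[OF h, of v w] by simp
  have "Im l \<noteq> 0"
  proof
    assume "Im l = 0"
    then have "cnj l = of_real (Re l)" by (simp add: complex_eq_iff)
    then have "\<forall>w\<in>U. pencil h g (- Re l) 1 v w = 0" using gv by simp
    then show False using nondeg[of "- Re l" 1 v] v by auto
  qed
  \<comment> \<open>Both g(v,v) = l h(v,v) and h(v,v) are real; compare imaginary parts.\<close>
  moreover have "Im l * Re (h v v) = 0"
  proof -
    have "Im (g v v) = 0" "Im (h v v) = 0"
      using hermitian_form_self[OF g, of v] hermitian_form_self[OF h, of v]
      by (metis Im_complex_of_real)+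
    then show ?thesis using v(3)[OF v(1)] by simp
  qed
  ultimately have "h v v = 0" using hermitian_form_self[OF h, of v] by simp
  then have "reducing_vector h g U v"
    unfolding reducing_vector_def using v gv by (intro conjI exI[of _ "- cnj l"] exI[of _ 1]) auto
  then show ?thesis by (rule that)
qed

section \<open>The last admissible shift\<close>

text \<open>The admissible shifts are bounded and contain their supremum. Just beyond it there are
  forms with a negative subspace of dimension above dim U - k; a limit of their directions cannot
  have a positive subspace of dimension k, as this would persist nearby and meet the large negative
  subspace.\<close>

lemma boundary_shift:
  assumes n: "hermitian_form n" and h: "hermitian_form h" and g: "hermitian_form g"
    and U: "fin_subspace U" and nU: "pos_on n U" and ic: "index_condition h g U k" and k: "0 < k"
  obtains s x y where "0 \<le> s" "index_condition (pencil h n 1 (- s)) g U k" "(x, y) \<noteq> (0, 0)"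
    "\<And>P. subspace P \<Longrightarrow> P \<subseteq> U \<Longrightarrow> pos_on (pencil (pencil h n 1 (- s)) g x y) P \<Longrightarrow> dim P < k"
proof -
  define hs where "hs s = pencil h n 1 (- s)" for s
  have hs: "hermitian_form (hs s)" for s unfolding hs_def by (rule hermitian_form_lincomb[OF h n])
  have sU: "subspace U" by (rule fin_subspace_imp_subspace[OF U])
  define S where "S = {s. 0 \<le> s \<and> index_condition (hs s) g U k}"
  have "hs 0 = h" unfolding hs_def by simp
  then have S0: "0 \<in> S" using ic unfolding S_def by simp
  obtain C where C: "0 \<le> C" "\<And>q. q \<in> U \<Longrightarrow> \<bar>Re (h q q)\<bar> \<le> C * Re (n q q)"
    using pos_on_bound[OF n h U nU] by blast
  have "s \<le> C" if s: "s \<in> S" for s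
  proof (rule ccontr)
    assume "\<not> s \<le> C"
    \<comment> \<open>Beyond \<open>C\<close> the shifted form is negative on all of
      \<open>U\<close>, against the bound for positive k.\<close>
    have "neg_on (pencil (hs s) g 1 0) U" unfolding pos_on_def
    proof (intro ballI impI)
      fix q assume q: "q \<in> U" "q \<noteq> 0"
      have "0 < Re (n q q)" by (rule pos_onD[OF nU q])
      then have "C * Re (n q q) < s * Re (n q q)" using \<open>\<not> s \<le> C\<close> by simp
      then show "0 < Re (- pencil (hs s) g 1 0 q q)" using C(2)[OF q(1)] unfolding hs_def by simp
    qed
    then have "dim U + k \<le> dim U" using s index_conditionD[of "hs s" g U k U] sU unfolding S_def by blast
    then show False using k by simp
  qed
  then have bdd: "bdd_above S" by (intro bdd_aboveI) auto
  define s0 where "s0 = Sup S"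
  have s0: "0 \<le> s0" unfolding s0_def by (rule cSup_upper[OF S0 bdd])
  have ic0: "index_condition (hs s0) g U k"
    unfolding index_condition_def
  proof (intro allI impI)
    fix x y Q assume Q: "subspace Q" "Q \<subseteq> U" "neg_on (pencil (hs s0) g x y) Q"
    obtain d where d: "0 < d"
      "\<And>a. \<bar>a\<bar> < d \<Longrightarrow> pos_on (\<lambda>u w. - pencil (hs s0) g x y u w + of_real a * n u w) Q"
      using pos_on_perturb[OF hermitian_form_uminus[OF hermitian_form_lincomb[OF hs g]] n
          fin_subspace_subset[OF U Q(1,2)] Q(3)] by blast
    \<comment> \<open>Passing from \<open>s0\<close> to \<open>s\<close> adds x (s - s0) times
      \<open>n\<close> to the negated form, and this coefficient must stay below \<open>d\<close>.
      The summand 1 covers x = 0. Thus a subspace negative at \<open>s0\<close> is also negative at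
      an admissible \<open>s\<close>.\<close>
    have "s0 - d / (\<bar>x\<bar> + 1) < s0" using d(1) by simp
    then obtain s where s: "s \<in> S" "s0 - d / (\<bar>x\<bar> + 1) < s"
      unfolding s0_def using less_cSup_iff[of S] S0 bdd by blast
    have "s \<le> s0" unfolding s0_def by (rule cSup_upper[OF s(1) bdd])
    then have "\<bar>x * (s - s0)\<bar> \<le> (\<bar>x\<bar> + 1) * (s0 - s)" by (simp add: abs_mult mult_right_mono)
    also have "\<dots> < d" using s(2) by (simp add: field_simps)
    finally have "pos_on (\<lambda>u w. - pencil (hs s0) g x y u w + of_real (x * (s - s0)) * n u w) Q"
      by (rule d(2))
    moreover have "(\<lambda>u w. - pencil (hs s0) g x y u w + of_real (x * (s - s0)) * n u w)
        = (\<lambda>u w. - pencil (hs s) g x y u w)"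
      unfolding hs_def by (intro ext) (simp add: algebra_simps)
    ultimately have "neg_on (pencil (hs s) g x y) Q" by simp
    then show "dim Q + k \<le> dim U" using s(1) index_conditionD[OF _ Q(1,2)] unfolding S_def by blast
  qed
  define sm where "sm m = s0 + 1 / real (Suc m)" for m
  define violates where "violates m x y Q \<longleftrightarrow> x\<^sup>2 + y\<^sup>2 = 1 \<and> subspace Q \<and> Q \<subseteq> U \<and>
      neg_on (pencil (hs (sm m)) g x y) Q \<and> dim U < dim Q + k" for m x y Q
  have "\<exists>x y Q. violates m x y Q" for m
  proof -
    have "sm m \<notin> S" using cSup_upper[OF _ bdd, of "sm m"] unfolding s0_def[symmetric] sm_def by auto
    then have "\<not> index_condition (hs (sm m)) g U k" using s0 unfolding S_def sm_def by simp
    then obtain x y Q where Q: "subspace Q" "Q \<subseteq> U" "neg_on (pencil (hs (sm m)) g x y) Q"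
      "dim U < dim Q + k" unfolding index_condition_def by (meson not_le)
    define r where "r = sqrt (x\<^sup>2 + y\<^sup>2)"
    \<comment> \<open>At (0, 0) each shift gives the zero form, which obeys the bound; so a
      violating direction can be normalized.\<close>
    have "(x, y) \<noteq> (0, 0)"
    proof
      assume "(x, y) = (0, 0)"
      then have "neg_on (pencil h g 0 0) Q" using Q(3) by simp
      then have "dim Q + k \<le> dim U" by (rule index_conditionD[OF ic Q(1,2)])
      then show False using Q(4) by simp
    qed
    then have "0 < x\<^sup>2 + y\<^sup>2" by (simp add: sum_power2_gt_zero_iff)
    then have r: "0 < r" "r\<^sup>2 = x\<^sup>2 + y\<^sup>2" unfolding r_def by simp_all
    have "(x / r)\<^sup>2 + (y / r)\<^sup>2 = (x\<^sup>2 + y\<^sup>2) / r\<^sup>2" by (simp add: power_divide add_divide_distrib)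
    also have "\<dots> = 1" unfolding r(2)[symmetric] using r(1) by simp
    finally have "(x / r)\<^sup>2 + (y / r)\<^sup>2 = 1" .
    moreover have "neg_on (pencil (hs (sm m)) g (x / r) (y / r)) Q" unfolding pos_on_def
    proof (intro ballI impI)
      fix q assume q: "q \<in> Q" "q \<noteq> 0"
      have "0 < Re (- pencil (hs (sm m)) g x y q q) / r" using pos_onD[OF Q(3) q] r(1) by simp
      then show "0 < Re (- pencil (hs (sm m)) g (x / r) (y / r) q q)" by (simp add: diff_divide_distrib)
    qed
    ultimately have "violates m (x / r) (y / r) Q" unfolding violates_def using Q by blast
    then show ?thesis by blast
  qed
  then obtain X Y Qm where "violates m (X m) (Y m) (Qm m)" for m by metis
  then have XY: "\<And>m. (X m)\<^sup>2 + (Y m)\<^sup>2 = 1"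
    and Qm: "\<And>m. subspace (Qm m)" "\<And>m. Qm m \<subseteq> U"
      "\<And>m. neg_on (pencil (hs (sm m)) g (X m) (Y m)) (Qm m)" "\<And>m. dim U < dim (Qm m) + k"
    unfolding violates_def by blast+
  obtain r x y where r: "strict_mono r" "(\<lambda>m. X (r m)) \<longlonglongrightarrow> x" "(\<lambda>m. Y (r m)) \<longlonglongrightarrow> y" "x\<^sup>2 + y\<^sup>2 = 1"
    by (rule unit_circle_convergent_subsequence[of X Y, OF XY])
  have "dim P < k"
    if P: "subspace P" "P \<subseteq> U" "pos_on (pencil (hs s0) g x y) P" for P
  proof (rule ccontr)
    assume "\<not> dim P < k"
    obtain d where d: "0 < d" "\<And>a b c. \<bar>a\<bar> < d \<Longrightarrow> \<bar>b\<bar> < d \<Longrightarrow> \<bar>c\<bar> < d \<Longrightarrow>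
        pos_on (\<lambda>u w. pencil (hs s0) g x y u w +
          (of_real a * h u w + of_real b * g u w + of_real c * n u w)) P"
      using pos_on_perturb3[OF hermitian_form_lincomb[OF hs g] h g n fin_subspace_subset[OF U P(1,2)] P(3)]
      by blast
    have "sm \<longlonglongrightarrow> s0 + 0" unfolding sm_def
      by (intro tendsto_add tendsto_const LIMSEQ_Suc[OF lim_1_over_n])
    then have sl: "(\<lambda>m. sm (r m)) \<longlonglongrightarrow> s0"
      using LIMSEQ_subseq_LIMSEQ[OF _ r(1)] by (fastforce simp: o_def)
    have "(\<lambda>m. X (r m) - x) \<longlonglongrightarrow> x - x" "(\<lambda>m. Y (r m) - y) \<longlonglongrightarrow> y - y"
      "(\<lambda>m. x * s0 - X (r m) * sm (r m)) \<longlonglongrightarrow> x * s0 - x * s0"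
      by (intro tendsto_intros r sl)+
    then have "\<forall>\<^sub>F m in sequentially. \<bar>X (r m) - x\<bar> < d" "\<forall>\<^sub>F m in sequentially. \<bar>Y (r m) - y\<bar> < d"
      "\<forall>\<^sub>F m in sequentially. \<bar>x * s0 - X (r m) * sm (r m)\<bar> < d"
      using d(1) unfolding tendsto_iff dist_real_def by simp_all
    then have "\<forall>\<^sub>F m in sequentially. \<bar>X (r m) - x\<bar> < d \<and> \<bar>Y (r m) - y\<bar> < d \<and>
        \<bar>x * s0 - X (r m) * sm (r m)\<bar> < d" by (intro eventually_conj)
    then obtain m where m: "\<bar>X (r m) - x\<bar> < d" "\<bar>Y (r m) - y\<bar> < d"
      "\<bar>x * s0 - X (r m) * sm (r m)\<bar> < d"
      using eventually_happens by fastforce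
    \<comment> \<open>The coefficients come from expanding X (h - sm n) - x (h - s0 n); all three
      tend to 0 along the subsequence.\<close>
    have eq: "(\<lambda>u w. pencil (hs s0) g x y u w + (of_real (X (r m) - x) * h u w +
          of_real (Y (r m) - y) * g u w + of_real (x * s0 - X (r m) * sm (r m)) * n u w))
        = pencil (hs (sm (r m))) g (X (r m)) (Y (r m))"
      unfolding hs_def by (intro ext) (simp add: algebra_simps)
    have pm: "pos_on (pencil (hs (sm (r m))) g (X (r m)) (Y (r m))) P"
      using d(2)[OF m] unfolding eq .
    \<comment> \<open>\<open>P\<close> is fixed while the negative subspaces vary freely with m; a
      single late m already produces a contradictory common vector.\<close>
    have "dim U < dim P + dim (Qm (r m))" using Qm(4)[of "r m"] \<open>\<not> dim P < k\<close> by simp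
    then obtain w where w: "w \<in> P" "w \<in> Qm (r m)" "w \<noteq> 0"
      using nonzero_in_Int[OF U P(1) Qm(1) P(2) Qm(2)] by blast
    show False using pos_onD[OF pm w(1,3)] pos_onD[OF Qm(3) w(2,3)] by simp
  qed
  moreover have "(x, y) \<noteq> (0, 0)" using r(4) by auto
  ultimately show ?thesis using that[OF s0] ic0 unfolding hs_def by blast
qed

section \<open>Common isotropic subspaces and the index condition\<close>

lemma index_condition_of_isotropic:
  assumes U: "fin_subspace U" and S: "subspace S" "S \<subseteq> U"
    and iso: "\<And>u. u \<in> S \<Longrightarrow> h u u = 0 \<and> g u u = 0"
  shows "index_condition h g U (dim S)"
  unfolding index_condition_def
proof (intro allI impI)
  fix x y Q assume Q: "subspace Q" "Q \<subseteq> U" "neg_on (pencil h g x y) Q"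
  have "u = 0" if "u \<in> Q" "u \<in> S" for u
    using pos_onD[OF Q(3) that(1)] iso[OF that(2)] by auto
  then have "Q \<inter> S = {0}" using subspace_0[OF Q(1)] subspace_0[OF S(1)] by blast
  then show "dim Q + dim S \<le> dim U" using dim_add_le_of_Int[OF U Q(1) S(1) Q(2) S(2)] by blast
qed

text \<open>The shifted forms and the complement of a reducing vector are fed back into the
  induction, hence \<open>h\<close>, \<open>g\<close> and \<open>U\<close> vary, while
  \<open>n\<close> stays fixed. If an extremal shift is 0, its subspace is already isotropic;
  otherwise \<open>h\<close> is positive on \<open>X1\<close> and negative on \<open>X2\<close> off
  0, and these span dimension 2 (k + 1).\<close>

lemma isotropic_subspace_exists:
  assumes n: "hermitian_form n"
    and "hermitian_form h" "hermitian_form g" "fin_subspace U" "pos_on n U" "index_condition h g U k"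
  shows "\<exists>S. subspace S \<and> S \<subseteq> U \<and> dim S = k \<and> (\<forall>u\<in>S. \<forall>w\<in>S. h u w = 0 \<and> g u w = 0)"
  using assms(2-)
proof (induction k arbitrary: h g U)
  case 0
  have "dim {0} = 0" using dim_span_eq_card_independent[OF independent_empty] by simp
  then show ?case using subspace_0[OF fin_subspace_imp_subspace[OF 0(3)]]
    by (intro exI[of _ "{0}"]) (auto simp: hermitian_formD[OF 0(1)] hermitian_formD[OF 0(2)])
next
  case (Suc k)
  \<comment> \<open>The subspace found in \<open>W\<close> is annihilated by \<open>v\<close> under
    both forms, and \<open>v\<close> is isotropic, so adjoining \<open>v\<close> keeps both forms
    zero; \<open>v\<close> lies outside \<open>W\<close>, so the dimension grows.\<close>
  have lift: "\<exists>S. subspace S \<and> S \<subseteq> U \<and> dim S = Suc k \<and> (\<forall>u\<in>S. \<forall>w\<in>S. h u w = 0 \<and> g u w = 0)"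
    if h: "hermitian_form h" and g: "hermitian_form g" and U: "fin_subspace U" and nU: "pos_on n U"
      and ic: "index_condition h g U (Suc k)" and v: "reducing_vector h g U v" for h g U v
  proof -
    obtain W where W: "subspace W" "W \<subseteq> U" "v \<notin> W" "\<And>w. w \<in> W \<Longrightarrow> h v w = 0 \<and> g v w = 0"
      "index_condition h g W k"
      using reducing_vector_step[OF n h g U nU ic v] by blast
    have fW: "fin_subspace W" by (rule fin_subspace_subset[OF U W(1,2)])
    obtain S where S: "subspace S" "S \<subseteq> W" "dim S = k" "\<And>u w. u \<in> S \<Longrightarrow> w \<in> S \<Longrightarrow> h u w = 0 \<and> g u w = 0"
      using Suc.IH[OF h g fW pos_on_subset[OF nU W(2)] W(5)] by blast
    have vU: "v \<in> U" "h v v = 0" "g v v = 0" using v unfolding reducing_vector_def by auto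
    have vS: "h v w = 0" "g v w = 0" "h w v = 0" "g w v = 0" if "w \<in> S" for w
      using W(4)[of w] S(2) that hermitian_form_zero_sym[OF h, of v w] hermitian_form_zero_sym[OF g, of v w]
      by auto
    have dec: "\<exists>c s. s \<in> S \<and> u = s + c *s v" if u: "u \<in> span (insert v S)" for u
    proof -
      obtain c where "u - c *s v \<in> S" using in_span_insert_subspace[OF S(1) u] .
      then show ?thesis by (intro exI[of _ c] exI[of _ "u - c *s v"]) simp
    qed
    have "h u w = 0 \<and> g u w = 0" if uw: "u \<in> span (insert v S)" "w \<in> span (insert v S)" for u w
    proof -
      obtain c s c' s' where "s \<in> S" "u = s + c *s v" "s' \<in> S" "w = s' + c' *s v"
        using dec[OF uw(1)] dec[OF uw(2)] by blast
      then show ?thesis using vS vU(2,3) S(4) by (simp add: hermitian_formD[OF h] hermitian_formD[OF g])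
    qed
    moreover have "span (insert v S) \<subseteq> U"
      using vU(1) S(2) W(2) fin_subspace_imp_subspace[OF U] by (intro span_minimal) auto
    moreover have "dim (span (insert v S)) = Suc k"
      using dim_span_insert[OF fin_subspace_subset[OF fW S(1,2)], of v] S(2,3) W(3) by auto
    ultimately show ?thesis using subspace_span by blast
  qed
  note h = Suc.prems(1) and g = Suc.prems(2) and U = Suc.prems(3) and nU = Suc.prems(4)
    and ic = Suc.prems(5)
  \<comment> \<open>A common isotropic subspace for the extremal shift of h' is one on which h'
    equals s n. Used for \<open>h\<close> and for its negative.\<close>
  have shift: "\<exists>s\<ge>0. \<exists>S. subspace S \<and> S \<subseteq> U \<and> dim S = Suc k \<and>
      (\<forall>u\<in>S. \<forall>w\<in>S. h' u w = of_real s * n u w \<and> g u w = 0)"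
    if h': "hermitian_form h'" and ic': "index_condition h' g U (Suc k)" for h'
  proof -
    obtain s x y where s: "0 \<le> s" and ics: "index_condition (pencil h' n 1 (- s)) g U (Suc k)"
      and xy: "(x, y) \<noteq> (0, 0)"
      and pos: "\<And>P. subspace P \<Longrightarrow> P \<subseteq> U \<Longrightarrow> pos_on (pencil (pencil h' n 1 (- s)) g x y) P \<Longrightarrow> dim P < Suc k"
      using boundary_shift[OF n h' g U nU ic'] by blast
    have hs: "hermitian_form (pencil h' n 1 (- s))" by (rule hermitian_form_lincomb[OF h' n])
    obtain v where v: "reducing_vector (pencil h' n 1 (- s)) g U v"
      using reducing_vector_of_degenerate[OF n hs g U nU ics xy] pos by blast
    obtain S where "subspace S" "S \<subseteq> U" "dim S = Suc k"
      "\<forall>u\<in>S. \<forall>w\<in>S. pencil h' n 1 (- s) u w = 0 \<and> g u w = 0"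
      using lift[OF hs g U nU ics v] by blast
    then show ?thesis using s by (intro exI[of _ s] conjI exI[of _ S]) auto
  qed
  obtain s1 X1 where s1: "0 \<le> s1" and X1: "subspace X1" "X1 \<subseteq> U" "dim X1 = Suc k"
    "\<And>u w. u \<in> X1 \<Longrightarrow> w \<in> X1 \<Longrightarrow> h u w = of_real s1 * n u w \<and> g u w = 0"
    using shift[OF h ic] by blast
  have ic': "index_condition (\<lambda>u w. - h u w) g U (Suc k)"
    unfolding index_condition_def
  proof (intro allI impI)
    fix x y Q assume Q: "subspace Q" "Q \<subseteq> U" "neg_on (pencil (\<lambda>u w. - h u w) g x y) Q"
    then have "neg_on (pencil h g (- x) y) Q" by simp
    then show "dim Q + Suc k \<le> dim U" by (rule index_conditionD[OF ic Q(1,2)])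
  qed
  obtain s2 X2 where s2: "0 \<le> s2" and X2: "subspace X2" "X2 \<subseteq> U" "dim X2 = Suc k"
    "\<And>u w. u \<in> X2 \<Longrightarrow> w \<in> X2 \<Longrightarrow> - h u w = of_real s2 * n u w \<and> g u w = 0"
    using shift[OF hermitian_form_uminus[OF h] ic'] by blast
  show ?case
  proof (cases "s1 = 0 \<or> s2 = 0")
    case True
    then show ?thesis
    proof
      assume "s1 = 0"
      then show ?thesis using X1 by (intro exI[of _ X1]) auto
    next
      assume "s2 = 0"
      then show ?thesis using X2 by (intro exI[of _ X2]) auto
    qed
  next
    case False
    then have pos: "0 < s1" "0 < s2" using s1 s2 by auto
    have "u = 0" if "u \<in> X1" "u \<in> X2" for u
    proof (rule ccontr)
      assume "u \<noteq> 0"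
      then have "0 < Re (n u u)" using pos_onD[OF nU] that(1) X1(2) by auto
      moreover have "Re (h u u) = s1 * Re (n u u)" "- Re (h u u) = s2 * Re (n u u)"
        using arg_cong[OF conjunct1[OF X1(4)[OF that(1,1)]], of Re]
          arg_cong[OF conjunct1[OF X2(4)[OF that(2,2)]], of Re] by simp_all
      ultimately show False using pos mult_pos_pos[of s1 "Re (n u u)"] mult_pos_pos[of s2 "Re (n u u)"] by linarith
    qed
    then have X12: "X1 \<inter> X2 = {0}" using subspace_0[OF X1(1)] subspace_0[OF X2(1)] by blast
    define V where "V = span (X1 \<union> X2)"
    have f12: "fin_subspace X1" "fin_subspace X2"
      using fin_subspace_subset[OF U] X1 X2 by auto
    have V: "fin_subspace V" "dim V = 2 * Suc k"
      using dim_span_Un_disjoint[OF f12 X12] X1(3) X2(3) unfolding V_def by auto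
    have VU: "V \<subseteq> U" unfolding V_def
      using X1(2) X2(2) fin_subspace_imp_subspace[OF U] by (intro span_minimal) auto
    have XV: "X1 \<subseteq> V" "X2 \<subseteq> V" unfolding V_def using span_superset by blast+
    \<comment> \<open>For x >= 0 the form is nonnegative on \<open>X1\<close>, where
      \<open>g\<close> vanishes and \<open>h\<close> is a nonnegative multiple of \<open>n\<close>;
      for x < 0 the same holds on \<open>X2\<close>. A negative \<open>Q\<close> meets that subspace
      only in 0, and its dimension is k + 1.\<close>
    have icV: "index_condition h g V (Suc k)"
      unfolding index_condition_def
    proof (intro allI impI)
      fix x y Q assume Q: "subspace Q" "Q \<subseteq> V" "neg_on (pencil h g x y) Q"
      show "dim Q + Suc k \<le> dim V"
      proof (cases "0 \<le> x")
        case True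
        have "u = 0" if "u \<in> Q" "u \<in> X1" for u
        proof (rule ccontr)
          assume u: "u \<noteq> 0"
          have "0 < Re (n u u)" using pos_onD[OF nU _ u] that(2) X1(2) by auto
          then have "0 \<le> x * (s1 * Re (n u u))" using True s1 by simp
          then show False using pos_onD[OF Q(3) that(1) u] X1(4)[OF that(2,2)] by simp
        qed
        then have "Q \<inter> X1 = {0}" using subspace_0[OF Q(1)] subspace_0[OF X1(1)] by blast
        then show ?thesis using dim_add_le_of_Int[OF V(1) Q(1) X1(1) Q(2) XV(1)] X1(3) by simp
      next
        case False
        have "u = 0" if "u \<in> Q" "u \<in> X2" for u
        proof (rule ccontr)
          assume u: "u \<noteq> 0"
          have "0 < Re (n u u)" using pos_onD[OF nU _ u] that(2) X2(2) by auto
          then have *: "x * (s2 * Re (n u u)) \<le> 0" using False s2 by (simp add: mult_nonpos_nonneg)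
          have "h u u = - (of_real s2 * n u u)" using X2(4)[OF that(2,2)] by (metis minus_minus)
          then show False using pos_onD[OF Q(3) that(1) u] X2(4)[OF that(2,2)] * by simp
        qed
        then have "Q \<inter> X2 = {0}" using subspace_0[OF Q(1)] subspace_0[OF X2(1)] by blast
        then show ?thesis using dim_add_le_of_Int[OF V(1) Q(1) X2(1) Q(2) XV(2)] X2(3) by simp
      qed
    qed
    obtain v where "reducing_vector h g V v"
      using reducing_vector_half_dim[OF n h g V(1) pos_on_subset[OF nU VU] icV _ V(2)] by blast
    from lift[OF h g V(1) pos_on_subset[OF nU VU] icV this] show ?thesis using VU by blast
  qed
qed

section \<open>Equivalent forms of the index condition\<close>

text \<open>At most \<open>d\<close> positive eigenvalues, in a form that mentions no basis;
  \<open>pos_index_le_diagonal\<close> gives the link.\<close>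

definition pos_index_le :: "('a \<Rightarrow> 'a \<Rightarrow> complex) \<Rightarrow> 'a set \<Rightarrow> nat \<Rightarrow> bool" where
  "pos_index_le f U d \<longleftrightarrow> (\<forall>Q. subspace Q \<longrightarrow> Q \<subseteq> U \<longrightarrow> pos_on f Q \<longrightarrow> dim Q \<le> d)"

text \<open>Sylvester's law of inertia: the positive basis vectors span a positive subspace, and
  every positive subspace meets the span of the others only in 0.\<close>

lemma pos_index_le_diagonal:
  assumes n: "hermitian_form n" and f: "hermitian_form f"
    and B: "finite B" "orthonormal n B" and d: "diagonal_on f B e"
  shows "pos_index_le f (span B) m \<longleftrightarrow> card {b\<in>B. 0 < e b} \<le> m"
proof -
  define Bp Bn where "Bp = {b\<in>B. 0 < e b}" and "Bn = {b\<in>B. e b \<le> 0}"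
  have Bpn: "Bp \<subseteq> B" "Bn \<subseteq> B" "finite Bp" "finite Bn" "Bp \<union> Bn = B" "Bp \<inter> Bn = {}"
    using B(1) unfolding Bp_def Bn_def by auto
  have on: "orthonormal n Bp" "orthonormal n Bn"
    using B(2) Bpn(1,2) unfolding orthonormal_def by blast+
  have dg: "diagonal_on f Bp e" "diagonal_on f Bn e"
    using d Bpn(1,2) unfolding diagonal_on_def by blast+
  have pos: "pos_on f (span Bp)"
    by (rule pos_on_diagonal_span[OF n f Bpn(3) on(1) dg(1)]) (simp add: Bp_def)
  have nonpos: "Re (f u u) \<le> 0" if "u \<in> span Bn" for u
    by (rule nonpos_diagonal_span[OF n f Bpn(4) on(2) dg(2) _ that]) (simp add: Bn_def)
  have c: "dim (span Bp) = card Bp" "dim (span Bn) = card Bn" "dim (span B) = card B"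
    using orthonormal_card[OF n Bpn(3) on(1)] orthonormal_card[OF n Bpn(4) on(2)]
      orthonormal_card[OF n B] by (simp_all only:)
  have cB: "card Bp + card Bn = card B" using card_Un_disjoint[OF Bpn(3,4,6)] Bpn(5) by simp
  have "dim Q \<le> card Bp" if Q: "subspace Q" "Q \<subseteq> span B" "pos_on f Q" for Q
  proof -
    have "u = 0" if "u \<in> Q" "u \<in> span Bn" for u
      using pos_onD[OF Q(3) that(1)] nonpos[OF that(2)] by fastforce
    then have "Q \<inter> span Bn = {0}" using subspace_0[OF Q(1)] span_zero by blast
    then have "dim Q + dim (span Bn) \<le> dim (span B)"
      using dim_add_le_of_Int[OF fin_subspace_span[OF B(1)] Q(1) subspace_span Q(2) span_mono[OF Bpn(2)]]
      by blast
    then show ?thesis unfolding c cB[symmetric] by simp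
  qed
  moreover have "span Bp \<subseteq> span B" by (rule span_mono[OF Bpn(1)])
  ultimately show ?thesis
    unfolding pos_index_le_def Bp_def[symmetric] c(1)[symmetric] using pos le_trans subspace_span
    by (intro iffI allI impI) blast+
qed

text \<open>The pencil contains the negative of each of its forms, so bounding all negative indices
  bounds all positive ones. This is why (b) and (c), and likewise (d) and (e), agree.\<close>

lemma index_condition_iff_pos_index_le:
  assumes "k \<le> dim U"
  shows "index_condition h g U k \<longleftrightarrow> (\<forall>x y. pos_index_le (pencil h g x y) U (dim U - k))"
proof -
  have *: "neg_on (pencil h g (- x) (- y)) Q \<longleftrightarrow> pos_on (pencil h g x y) Q" for x y Q
    unfolding pos_on_def by (simp add: add.commute)
  show ?thesis
  proof
    assume ic: "index_condition h g U k"
    have "dim Q \<le> dim U - k" if "subspace Q" "Q \<subseteq> U" "pos_on (pencil h g x y) Q" for x y Q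
      using index_conditionD[OF ic that(1,2), of "- x" "- y"] that(3) assms unfolding * by simp
    then show "\<forall>x y. pos_index_le (pencil h g x y) U (dim U - k)" unfolding pos_index_le_def by blast
  next
    assume le: "\<forall>x y. pos_index_le (pencil h g x y) U (dim U - k)"
    show "index_condition h g U k" unfolding index_condition_def
    proof (intro allI impI)
      fix x y Q assume Q: "subspace Q" "Q \<subseteq> U" "neg_on (pencil h g x y) Q"
      have "pos_on (pencil h g (- x) (- y)) Q" using Q(3) *[of "- x" "- y" Q] by simp
      then have "dim Q \<le> dim U - k" using le Q(1,2) unfolding pos_index_le_def by blast
      then show "dim Q + k \<le> dim U" using assms by simp
    qed
  qed
qed

lemma index_condition_iff_neg_index_le:
  assumes "k \<le> dim U"
  shows "index_condition h g U k \<longleftrightarrow>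
    (\<forall>x y. pos_index_le (\<lambda>u w. - pencil h g x y u w) U (dim U - k))"
  unfolding index_condition_def pos_index_le_def using assms by (simp add: le_diff_conv2)

lemma pos_index_le_cong_scale:
  assumes "c > 0" "\<And>u. Re (f' u u) = c * Re (f u u)"
  shows "pos_index_le f' U d \<longleftrightarrow> pos_index_le f U d"
  unfolding pos_index_le_def pos_on_def assms(2) using assms(1) by (simp add: zero_less_mult_iff)

text \<open>Dividing by x reduces x > 0 to x = 1. For x < 0 this reverses the sign, so the bound on
  the positive index takes over. The remaining line x = 0 is reached by openness.\<close>

lemma index_condition_iff_affine:
  assumes h: "hermitian_form h" and g: "hermitian_form g" and U: "fin_subspace U" and k: "k \<le> dim U"
  shows "index_condition h g U k \<longleftrightarrow>
    (\<forall>y. pos_index_le (\<lambda>u w. - pencil h g 1 y u w) U (dim U - k) \<and>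
         pos_index_le (pencil h g 1 y) U (dim U - k))"
proof
  assume "index_condition h g U k"
  then show "\<forall>y. pos_index_le (\<lambda>u w. - pencil h g 1 y u w) U (dim U - k) \<and>
         pos_index_le (pencil h g 1 y) U (dim U - k)"
    using index_condition_iff_pos_index_le[OF k, of h g] index_condition_iff_neg_index_le[OF k, of h g]
    by blast
next
  assume *: "\<forall>y. pos_index_le (\<lambda>u w. - pencil h g 1 y u w) U (dim U - k) \<and>
         pos_index_le (pencil h g 1 y) U (dim U - k)"
  have pos: "pos_index_le (\<lambda>u w. - pencil h g x y u w) U (dim U - k)" if x: "x > 0" for x y
  proof -
    have "pos_index_le (\<lambda>u w. - pencil h g 1 (y / x) u w) U (dim U - k)" using * by blast
    then show ?thesis
      using pos_index_le_cong_scale[OF x, of "\<lambda>u w. - pencil h g x y u w" "\<lambda>u w. - pencil h g 1 (y / x) u w"]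
        x by (simp add: algebra_simps)
  qed
  have neg: "pos_index_le (\<lambda>u w. - pencil h g x y u w) U (dim U - k)" if x: "x < 0" for x y
  proof -
    have "pos_index_le (pencil h g 1 (y / x)) U (dim U - k)" using * by blast
    moreover have "0 < - x" using x by simp
    ultimately show ?thesis
      using pos_index_le_cong_scale[of "- x" "\<lambda>u w. - pencil h g x y u w" "pencil h g 1 (y / x)"]
        x by (simp add: algebra_simps)
  qed
  \<comment> \<open>A subspace negative at (0, y) stays negative at (d / 2, y), where the bound is
    already known.\<close>
  have zero: "pos_index_le (\<lambda>u w. - pencil h g 0 y u w) U (dim U - k)" for y
    unfolding pos_index_le_def
  proof (intro allI impI)
    fix Q assume Q: "subspace Q" "Q \<subseteq> U" "neg_on (pencil h g 0 y) Q"
    obtain d where d: "0 < d"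
      "\<And>c. \<bar>c\<bar> < d \<Longrightarrow> pos_on (\<lambda>u w. - pencil h g 0 y u w + of_real c * h u w) Q"
      using pos_on_perturb[OF hermitian_form_uminus[OF hermitian_form_lincomb[OF h g]] h
          fin_subspace_subset[OF U Q(1,2)] Q(3)] by blast
    have "neg_on (pencil h g (d / 2) y) Q" using d(2)[of "- d / 2"] d(1) by (simp add: algebra_simps)
    then show "dim Q \<le> dim U - k"
      using pos[of "d / 2" y] d(1) Q(1,2) unfolding pos_index_le_def by simp
  qed
  have "pos_index_le (\<lambda>u w. - pencil h g x y u w) U (dim U - k)" for x y
    using pos[of x y] neg[of x y] zero[of y] by (cases x "0 :: real" rule: linorder_cases) auto
  then show "index_condition h g U k" using index_condition_iff_neg_index_le[OF k] by blast
qed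

lemma form_zero_on_span:
  assumes f: "hermitian_form f" and z: "\<And>u w. u \<in> B \<Longrightarrow> w \<in> B \<Longrightarrow> f u w = 0"
    and u: "u \<in> span B" and w: "w \<in> span B"
  shows "f u w = 0"
proof -
  have 1: "f b w = 0" if b: "b \<in> B" for b
    using w
  proof (induction rule: span_induct)
    case base
    show ?case unfolding subspace_def by (auto simp: hermitian_formD[OF f])
  qed (use z b in auto)
  show ?thesis
    using u
  proof (induction rule: span_induct)
    case base
    show ?case unfolding subspace_def by (auto simp: hermitian_formD[OF f])
  qed (use 1 in auto)
qed

end

section \<open>Ordered eigenvalues as counts\<close>

text \<open>The j-th largest value is entry n - j of the ascending list, counted from 0. If it is
  below \<open>c\<close>, so are n - j + 1 entries; if it is above \<open>c\<close>, so are j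
  entries.\<close>

lemma nth_rev_sorted_ge_iff:
  fixes E :: "'a::linorder multiset"
  assumes "size E = n" "1 \<le> j" "j \<le> n"
  shows "c \<le> rev (sorted_list_of_multiset E) ! (j - 1) \<longleftrightarrow> size {#e \<in># E. e < c#} \<le> n - j"
    and "rev (sorted_list_of_multiset E) ! (j - 1) \<le> c \<longleftrightarrow> size {#e \<in># E. c < e#} \<le> j - 1"
proof -
  define xs where "xs = sorted_list_of_multiset E"
  have xs: "sorted xs" "mset xs = E" unfolding xs_def by simp_all
  have len: "length xs = n" using assms(1) xs(2) by (metis size_mset)
  have nth: "rev xs ! (j - 1) = xs ! (n - j)" using assms len by (simp add: rev_nth)
  have mono: "xs ! i \<le> xs ! i'" if "i \<le> i'" "i' < n" for i i'
    using sorted_nth_mono[OF xs(1)] that len by simp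
  have size: "size {#e \<in># E. P e#} = card {i. i < n \<and> P (xs ! i)}" for P
  proof -
    have "size {#e \<in># E. P e#} = length (filter P xs)"
      unfolding xs(2)[symmetric] by (simp flip: mset_filter)
    then show ?thesis by (simp add: length_filter_conv_card len)
  qed
  show "c \<le> rev (sorted_list_of_multiset E) ! (j - 1) \<longleftrightarrow> size {#e \<in># E. e < c#} \<le> n - j"
    unfolding xs_def[symmetric] nth size
  proof (cases "c \<le> xs ! (n - j)")
    case True
    have "{i. i < n \<and> xs ! i < c} \<subseteq> {..<n - j}"
    proof
      fix i assume "i \<in> {i. i < n \<and> xs ! i < c}"
      then have i: "i < n" "xs ! i < c" by auto
      have "\<not> n - j \<le> i"
      proof
        assume "n - j \<le> i"
        then have "xs ! (n - j) \<le> xs ! i" using i(1) by (rule mono)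
        then show False using True i(2) by simp
      qed
      then show "i \<in> {..<n - j}" by simp
    qed
    then have "card {i. i < n \<and> xs ! i < c} \<le> card {..<n - j}" by (intro card_mono) auto
    then show "c \<le> xs ! (n - j) \<longleftrightarrow> card {i. i < n \<and> xs ! i < c} \<le> n - j" using True by simp
  next
    case False
    have "{..n - j} \<subseteq> {i. i < n \<and> xs ! i < c}"
    proof
      fix i assume "i \<in> {..n - j}"
      then have "i \<le> n - j" "n - j < n" using assms by auto
      then show "i \<in> {i. i < n \<and> xs ! i < c}" using mono[of i "n - j"] False by auto
    qed
    then have "card {..n - j} \<le> card {i. i < n \<and> xs ! i < c}" by (intro card_mono) auto
    then show "c \<le> xs ! (n - j) \<longleftrightarrow> card {i. i < n \<and> xs ! i < c} \<le> n - j" using False by simp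
  qed
  show "rev (sorted_list_of_multiset E) ! (j - 1) \<le> c \<longleftrightarrow> size {#e \<in># E. c < e#} \<le> j - 1"
    unfolding xs_def[symmetric] nth size
  proof (cases "xs ! (n - j) \<le> c")
    case True
    have "{i. i < n \<and> c < xs ! i} \<subseteq> {n - j<..<n}"
    proof
      fix i assume "i \<in> {i. i < n \<and> c < xs ! i}"
      then have i: "i < n" "c < xs ! i" by auto
      have "\<not> i \<le> n - j"
      proof
        assume "i \<le> n - j"
        then have "xs ! i \<le> xs ! (n - j)" using assms by (intro mono) auto
        then show False using True i(2) by simp
      qed
      then show "i \<in> {n - j<..<n}" using i by auto
    qed
    then have "card {i. i < n \<and> c < xs ! i} \<le> card {n - j<..<n}" by (intro card_mono) auto
    then show "xs ! (n - j) \<le> c \<longleftrightarrow> card {i. i < n \<and> c < xs ! i} \<le> j - 1" using True assms by simp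
  next
    case False
    have "{n - j..<n} \<subseteq> {i. i < n \<and> c < xs ! i}"
    proof
      fix i assume "i \<in> {n - j..<n}"
      then have "i < n" "xs ! (n - j) \<le> xs ! i" using mono[of "n - j" i] by auto
      then show "i \<in> {i. i < n \<and> c < xs ! i}" using False by auto
    qed
    then have "card {n - j..<n} \<le> card {i. i < n \<and> c < xs ! i}" by (intro card_mono) auto
    then show "xs ! (n - j) \<le> c \<longleftrightarrow> card {i. i < n \<and> c < xs ! i} \<le> j - 1" using False assms by simp
  qed
qed

section \<open>Matrices as forms\<close>

text \<open>
  All dimensions \<open>n\<close> live in the single type \<open>nat \<Rightarrow> complex\<close>: the space of \<open>n\<close>-vectors is the
  subspace \<open>coord_space n\<close> of functions vanishing from \<open>n\<close> on.
\<close>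

definition fun_scale :: "complex \<Rightarrow> (nat \<Rightarrow> complex) \<Rightarrow> nat \<Rightarrow> complex" where
  "fun_scale c u = (\<lambda>i. c * u i)"

interpretation fun_space: complex_space fun_scale
  by unfold_locales (auto simp: fun_scale_def fun_eq_iff algebra_simps)

definition coord_space :: "nat \<Rightarrow> (nat \<Rightarrow> complex) set" where
  "coord_space n = {u. \<forall>i\<ge>n. u i = 0}"

definition mat_form :: "nat \<Rightarrow> complex mat \<Rightarrow> (nat \<Rightarrow> complex) \<Rightarrow> (nat \<Rightarrow> complex) \<Rightarrow> complex" where
  "mat_form n M u w = (\<Sum>i<n. \<Sum>j<n. cnj (u i) * M $$ (i, j) * w j)"

text \<open>Only semidefinite on the whole type, since it ignores coordinates from \<open>n\<close>
  on; it is definite on \<open>coord_space n\<close> and plays the part of the reference form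
  there.\<close>

definition std_form :: "nat \<Rightarrow> (nat \<Rightarrow> complex) \<Rightarrow> (nat \<Rightarrow> complex) \<Rightarrow> complex" where
  "std_form n u w = (\<Sum>i<n. cnj (u i) * w i)"

lemma mat_form_add:
  assumes "A \<in> carrier_mat n n" "B \<in> carrier_mat n n"
  shows "mat_form n (A + B) u w = mat_form n A u w + mat_form n B u w"
  using assms unfolding mat_form_def sum.distrib[symmetric]
  by (intro sum.cong refl) (simp add: algebra_simps)

lemma mat_form_smult:
  assumes "A \<in> carrier_mat n n"
  shows "mat_form n (c \<cdot>\<^sub>m A) u w = c * mat_form n A u w"
  using assms unfolding mat_form_def sum_distrib_left
  by (intro sum.cong refl) (simp add: algebra_simps)

lemma mat_form_one: "mat_form n (1\<^sub>m n) u w = std_form n u w"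
proof -
  have "(\<Sum>j<n. cnj (u i) * 1\<^sub>m n $$ (i, j) * w j) = cnj (u i) * w i" if "i < n" for i
  proof -
    have "(\<Sum>j<n. cnj (u i) * 1\<^sub>m n $$ (i, j) * w j) = (\<Sum>j<n. if j = i then cnj (u i) * w i else 0)"
      using that by (intro sum.cong refl) auto
    then show ?thesis using that by simp
  qed
  then show ?thesis unfolding mat_form_def std_form_def by (intro sum.cong refl) auto
qed

lemma hermitian_std_form: "fun_space.hermitian_form (std_form n)"
  unfolding fun_space.hermitian_form_def std_form_def fun_scale_def
  by (auto simp: sum.distrib sum_distrib_left algebra_simps intro!: sum.cong)

lemma hermitian_mat_form:
  assumes M: "M \<in> carrier_mat n n" and adj: "mat_adjoint M = M"
  shows "fun_space.hermitian_form (mat_form n M)"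
  unfolding fun_space.hermitian_form_def
proof (intro conjI allI)
  fix u v w c
  show "mat_form n M u (v + w) = mat_form n M u v + mat_form n M u w"
    unfolding mat_form_def by (simp add: sum.distrib algebra_simps)
  show "mat_form n M u (fun_scale c v) = c * mat_form n M u v"
    unfolding mat_form_def fun_scale_def sum_distrib_left by (intro sum.cong refl) simp
  have *: "cnj (M $$ (i, j)) = M $$ (j, i)" if "i < n" "j < n" for i j
    using index_mat_adjoint[of j M i] adj M that by simp
  have "cnj (mat_form n M u v) = (\<Sum>i<n. \<Sum>j<n. cnj (v j) * M $$ (j, i) * u i)"
    unfolding mat_form_def cnj_sum by (intro sum.cong refl) (simp add: * mult_ac)
  then show "mat_form n M v u = cnj (mat_form n M u v)"
    unfolding mat_form_def by (simp add: sum.swap[of "\<lambda>i j. cnj (v j) * M $$ (j, i) * u i"])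
qed

lemma pos_on_std_form: "fun_space.pos_on (std_form n) (coord_space n)"
  unfolding fun_space.pos_on_def
proof (intro ballI impI)
  fix u assume u: "u \<in> coord_space n" "u \<noteq> 0"
  obtain i where "u i \<noteq> 0" using u(2) by (auto simp: fun_eq_iff)
  then have i: "i < n" "u i \<noteq> 0" using u(1) by (auto simp: coord_space_def not_le[symmetric])
  have "Re (std_form n u u) = (\<Sum>i<n. (cmod (u i))\<^sup>2)"
    unfolding std_form_def Re_sum by (intro sum.cong refl) (simp add: cmod_power2, simp add: power2_eq_square)
  also have "\<dots> > 0" by (rule sum_pos2[of _ i]) (use i in auto)
  finally show "0 < Re (std_form n u u)" .
qed

lemma coord_space_fin: "fun_space.fin_subspace (coord_space n)"
  and dim_coord_space: "fun_space.dim (coord_space n) = n"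
proof -
  define e :: "nat \<Rightarrow> nat \<Rightarrow> complex" where "e i = (\<lambda>j. if j = i then 1 else 0)" for i
  define B where "B = e ` {..<n}"
  have inj: "inj e" unfolding e_def inj_def by (metis zero_neq_one)
  have fin: "finite B" unfolding B_def by simp
  have apply_sum: "(\<Sum>i<m. F i) j = (\<Sum>i<m. F i j)" for F :: "nat \<Rightarrow> nat \<Rightarrow> complex" and m j
    by (induction m) auto
  have "u \<in> fun_space.span B" if u: "u \<in> coord_space n" for u
  proof -
    have "u = (\<Sum>i<n. fun_scale (u i) (e i))"
    proof
      fix j
      have "(\<Sum>i<n. fun_scale (u i) (e i)) j = (\<Sum>i<n. if i = j then u j else 0)"
        unfolding apply_sum fun_scale_def e_def by (intro sum.cong) auto
      then show "u j = (\<Sum>i<n. fun_scale (u i) (e i)) j"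
        using u unfolding coord_space_def by auto
    qed
    moreover have "(\<Sum>i<n. fun_scale (u i) (e i)) \<in> fun_space.span B"
      unfolding B_def by (intro fun_space.span_sum fun_space.span_scale fun_space.span_base) auto
    ultimately show ?thesis by metis
  qed
  moreover have "fun_space.span B \<subseteq> coord_space n"
    by (rule fun_space.span_minimal)
      (auto simp: B_def e_def coord_space_def fun_space.subspace_def fun_scale_def)
  ultimately have B: "coord_space n = fun_space.span B" by auto
  show "fun_space.fin_subspace (coord_space n)" unfolding B by (rule fun_space.fin_subspace_span[OF fin])
  have "std_form n (e i) (e j) = (if e i = e j then 1 else 0)" if "i < n" "j < n" for i j
  proof -
    have "std_form n (e i) (e j) = (\<Sum>l<n. if l = i then (if i = j then 1 else 0) else 0)"
      unfolding std_form_def e_def by (intro sum.cong) auto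
    then show ?thesis using that inj by (simp add: inj_eq)
  qed
  then have "fun_space.orthonormal (std_form n) B" unfolding fun_space.orthonormal_def B_def by auto
  from fun_space.orthonormal_card[OF hermitian_std_form fin this]
  show "fun_space.dim (coord_space n) = n"
    unfolding B B_def using card_image[OF inj_on_subset[OF inj subset_UNIV]] by simp
qed

lemma index_mat_adjoint_mult:
  assumes X: "X \<in> carrier_mat n k" and Y: "Y \<in> carrier_mat n m" and pq: "p < k" "q < m"
  shows "(mat_adjoint X * Y) $$ (p, q) = (\<Sum>i<n. cnj (X $$ (i, p)) * Y $$ (i, q))"
  using assms by (simp add: scalar_prod_def atLeast0LessThan index_mat_adjoint)

lemma adjoint_mult_index:
  assumes "X \<in> carrier_mat n k" "p < k" "q < k"
  shows "(mat_adjoint X * X) $$ (p, q) = std_form n (\<lambda>i. X $$ (i, p)) (\<lambda>i. X $$ (i, q))"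
  unfolding std_form_def by (rule index_mat_adjoint_mult[OF assms(1,1,2,3)])

lemma adjoint_mult_mult_index:
  assumes M: "M \<in> carrier_mat n n" and X: "X \<in> carrier_mat n k" and pq: "p < k" "q < k"
  shows "(mat_adjoint X * M * X) $$ (p, q) = mat_form n M (\<lambda>i. X $$ (i, p)) (\<lambda>i. X $$ (i, q))"
proof -
  have X': "mat_adjoint X \<in> carrier_mat k n" using X by simp
  have "(mat_adjoint X * M * X) $$ (p, q) = (mat_adjoint X * (M * X)) $$ (p, q)"
    using assoc_mult_mat[OF X' M X] by simp
  also have "\<dots> = (\<Sum>i<n. cnj (X $$ (i, p)) * (M * X) $$ (i, q))"
    by (rule index_mat_adjoint_mult[OF X mult_carrier_mat[OF M X] pq])
  also have "\<dots> = (\<Sum>i<n. cnj (X $$ (i, p)) * (\<Sum>j<n. M $$ (i, j) * X $$ (j, q)))"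
    using M X pq by (intro sum.cong refl) (simp add: scalar_prod_def atLeast0LessThan)
  finally show ?thesis unfolding mat_form_def by (simp add: sum_distrib_left mult.assoc)
qed

text \<open>Lets matrix columns, whose entries beyond the dimension are unspecified, be exchanged
  for functions in \<open>coord_space n\<close>.\<close>

lemma mat_form_cong:
  assumes "\<And>i. i < n \<Longrightarrow> u i = u' i" "\<And>i. i < n \<Longrightarrow> w i = w' i"
  shows "mat_form n M u w = mat_form n M u' w'" "std_form n u w = std_form n u' w'"
  unfolding mat_form_def std_form_def using assms by (auto intro!: sum.cong)

lemma proots_prod_linear: "proots (\<Prod>a\<leftarrow>as. [:- a, 1:]) = mset (as :: complex list)"
proof (induction as)
  case (Cons a as)
  have "(\<Prod>a\<leftarrow>as. [:- a, 1:]) \<noteq> 0" by (auto simp: prod_list_zero_iff)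
  then show ?case using Cons proots_mult[of "[:- a, 1:]" "\<Prod>a\<leftarrow>as. [:- a, 1:]"] by simp
qed simp

section \<open>Eigenvalues of Hermitian matrices through forms\<close>

text \<open>The orthonormal basis gives the columns of a unitary \<open>P\<close> that makes
  \<open>M\<close> similar to a diagonal \<open>D\<close>, and the characteristic polynomial of
  \<open>D\<close> shows its roots. Basis vectors are distinct even where their values coincide, so
  the image of \<open>mset_set B\<close> keeps multiplicities.\<close>

lemma herm_eigvals_diagonalization:
  assumes M: "M \<in> carrier_mat n n" and herm: "fun_space.hermitian_form (mat_form n M)"
  obtains B e where "finite B" "fun_space.orthonormal (std_form n) B" "coord_space n = fun_space.span B"
    "fun_space.diagonal_on (mat_form n M) B e" "herm_eigvals M = image_mset e (mset_set B)"
proof -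
  obtain B e where B: "finite B" "fun_space.orthonormal (std_form n) B" "coord_space n = fun_space.span B"
    and d: "fun_space.diagonal_on (mat_form n M) B e"
    using fun_space.simultaneous_diagonalization[OF hermitian_std_form herm coord_space_fin pos_on_std_form]
    by blast
  have cB: "card B = n"
    using fun_space.orthonormal_card[OF hermitian_std_form B(1,2)] B(3) dim_coord_space[of n] by simp
  obtain b where b: "bij_betw b {0..<n} B" using ex_bij_betw_nat_finite[OF B(1)] cB by auto
  have bB: "b i \<in> B" if "i < n" for i using b that by (auto simp: bij_betw_def)
  have binj: "b i = b j \<longleftrightarrow> i = j" if "i < n" "j < n" for i j
    using b that by (auto simp: bij_betw_def inj_on_def)
  define P where "P = mat n n (\<lambda>(i, p). b p i)"
  define D where "D = mat n n (\<lambda>(i, j). if i = j then complex_of_real (e (b i)) else 0)"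
  have P: "P \<in> carrier_mat n n" and D: "D \<in> carrier_mat n n" unfolding P_def D_def by simp_all
  define Q where "Q = mat_adjoint P"
  have Q: "Q \<in> carrier_mat n n" unfolding Q_def using P by simp
  have QP: "Q * P = 1\<^sub>m n"
  proof (rule eq_matI)
    fix p q assume "p < dim_row (1\<^sub>m n)" "q < dim_col (1\<^sub>m n)"
    then have pq: "p < n" "q < n" by auto
    have "(Q * P) $$ (p, q) = std_form n (b p) (b q)"
      unfolding Q_def adjoint_mult_index[OF P pq]
      by (rule mat_form_cong(2)) (simp_all add: P_def pq)
    also have "\<dots> = 1\<^sub>m n $$ (p, q)"
      using B(2) bB[OF pq(1)] bB[OF pq(2)] binj[OF pq] pq unfolding fun_space.orthonormal_def by simp
    finally show "(Q * P) $$ (p, q) = 1\<^sub>m n $$ (p, q)" .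
  qed (use P Q in auto)
  have QMP: "Q * M * P = D"
  proof (rule eq_matI)
    fix p q assume "p < dim_row D" "q < dim_col D"
    then have pq: "p < n" "q < n" using D by auto
    have "(Q * M * P) $$ (p, q) = mat_form n M (b p) (b q)"
      unfolding Q_def adjoint_mult_mult_index[OF M P pq]
      by (rule mat_form_cong(1)) (simp_all add: P_def pq)
    also have "\<dots> = D $$ (p, q)"
      using fun_space.diagonal_onD[OF d bB[OF pq(1)] bB[OF pq(2)]] binj[OF pq] pq unfolding D_def by simp
    finally show "(Q * M * P) $$ (p, q) = D $$ (p, q)" .
  qed (use P Q M D in auto)
  \<comment> \<open>For square matrices the left inverse is two-sided, which turns the congruence Q
    M P = D into a similarity.\<close>
  have PQ: "P * Q = 1\<^sub>m n" by (rule mat_mult_left_right_inverse[OF Q P QP])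
  have "P * D * Q = M"
  proof -
    have "P * D * Q = P * (Q * (M * P)) * Q" using QMP assoc_mult_mat[OF Q M P] by simp
    also have "P * (Q * (M * P)) = P * Q * (M * P)" using assoc_mult_mat[OF P Q mult_carrier_mat[OF M P]] by simp
    also have "\<dots> = M * P" unfolding PQ using M P by simp
    also have "M * P * Q = M * (P * Q)" by (rule assoc_mult_mat[OF M P Q])
    also have "\<dots> = M" unfolding PQ using M by simp
    finally show ?thesis .
  qed
  then have "similar_mat_wit M D P Q"
    unfolding similar_mat_wit_def Let_def using M D P Q PQ QP by auto
  then have "char_poly M = char_poly D" using char_poly_similar unfolding similar_mat_def by blast
  also have "upper_triangular D" unfolding upper_triangular_def D_def by auto
  then have "char_poly D = (\<Prod>a\<leftarrow>diag_mat D. [:- a, 1:])" by (rule char_poly_upper_triangular[OF D])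
  finally have "proots (char_poly M) = mset (diag_mat D)" by (simp only: proots_prod_linear)
  also have "diag_mat D = map (\<lambda>i. complex_of_real (e (b i))) [0..<n]"
    unfolding diag_mat_def D_def by (auto intro!: map_cong)
  finally have "herm_eigvals M = image_mset e (image_mset b (mset_set {0..<n}))"
    unfolding herm_eigvals_def by (simp add: multiset.map_comp o_def)
  also have "image_mset b (mset_set {0..<n}) = mset_set B"
    using b image_mset_mset_set[of b "{0..<n}"] unfolding bij_betw_def by simp
  finally show ?thesis using that B d by blast
qed

text \<open>Eigenvalues of \<open>M\<close> above \<open>c\<close> are positive eigenvalues of M - c
  I, and the same basis diagonalizes this shifted form.\<close>

lemma herm_eigvals_count:
  assumes M: "M \<in> carrier_mat n n" and herm: "fun_space.hermitian_form (mat_form n M)"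
  shows "size {#x \<in># herm_eigvals M. c < x#} \<le> m \<longleftrightarrow>
      fun_space.pos_index_le (fun_space.pencil (mat_form n M) (std_form n) 1 (- c)) (coord_space n) m"
    and "size {#x \<in># herm_eigvals M. x < c#} \<le> m \<longleftrightarrow>
      fun_space.pos_index_le (\<lambda>u w. - fun_space.pencil (mat_form n M) (std_form n) 1 (- c) u w) (coord_space n) m"
proof -
  obtain B e where B: "finite B" "fun_space.orthonormal (std_form n) B" "coord_space n = fun_space.span B"
    and d: "fun_space.diagonal_on (mat_form n M) B e" and E: "herm_eigvals M = image_mset e (mset_set B)"
    using herm_eigvals_diagonalization[OF M herm] .
  have size: "size {#x \<in># herm_eigvals M. P x#} = card {b\<in>B. P (e b)}" for P
    unfolding E using B(1) by (simp add: filter_mset_image_mset)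
  have pen: "fun_space.hermitian_form (fun_space.pencil (mat_form n M) (std_form n) 1 (- c))"
    by (rule fun_space.hermitian_form_lincomb[OF herm hermitian_std_form])
  have d1: "fun_space.diagonal_on (fun_space.pencil (mat_form n M) (std_form n) 1 (- c)) B (\<lambda>b. e b - c)"
    using d B(2) unfolding fun_space.diagonal_on_def fun_space.orthonormal_def by simp
  then have d2: "fun_space.diagonal_on (\<lambda>u w. - fun_space.pencil (mat_form n M) (std_form n) 1 (- c) u w) B (\<lambda>b. c - e b)"
    unfolding fun_space.diagonal_on_def by simp
  show "size {#x \<in># herm_eigvals M. c < x#} \<le> m \<longleftrightarrow>
      fun_space.pos_index_le (fun_space.pencil (mat_form n M) (std_form n) 1 (- c)) (coord_space n) m"
    unfolding size B(3) fun_space.pos_index_le_diagonal[OF hermitian_std_form pen B(1,2) d1] by simp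
  show "size {#x \<in># herm_eigvals M. x < c#} \<le> m \<longleftrightarrow>
      fun_space.pos_index_le (\<lambda>u w. - fun_space.pencil (mat_form n M) (std_form n) 1 (- c) u w) (coord_space n) m"
    unfolding size B(3)
      fun_space.pos_index_le_diagonal[OF hermitian_std_form fun_space.hermitian_form_uminus[OF pen] B(1,2) d2]
    by simp
qed

lemma mat_form_Re_Im:
  assumes "A \<in> carrier_mat n n"
  shows "mat_form n A u w = mat_form n (mat_Re A) u w + \<i> * mat_form n (mat_Im A) u w"
proof -
  have "A = mat_Re A + \<i> \<cdot>\<^sub>m mat_Im A"
  proof (rule eq_matI)
    fix i j assume "i < dim_row (mat_Re A + \<i> \<cdot>\<^sub>m mat_Im A)" "j < dim_col (mat_Re A + \<i> \<cdot>\<^sub>m mat_Im A)"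
    then have ij: "i < n" "j < n" using carrier_matD[OF mat_Im_carrier[OF assms]] by auto
    then show "A $$ (i, j) = (mat_Re A + \<i> \<cdot>\<^sub>m mat_Im A) $$ (i, j)"
      using carrier_matD[OF mat_Im_carrier[OF assms]]
      by (simp add: index_mat_Re[OF assms] index_mat_Im[OF assms] field_simps)
  qed (use assms carrier_matD[OF mat_Im_carrier[OF assms]] in auto)
  then show ?thesis
    using mat_form_add[OF mat_Re_carrier[OF assms] smult_carrier_mat[OF mat_Im_carrier[OF assms]]]
      mat_form_smult[OF mat_Im_carrier[OF assms]] by metis
qed

section \<open>The rank-k numerical range through isotropic subspaces\<close>

text \<open>\<open>S\<close> is the column space of \<open>X\<close>. The compression condition says
  that the sesquilinear form of A - (a + ib) I, which is h + i g, vanishes on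
  \<open>S\<close>.\<close>

lemma rank_numerical_range_iff_isotropic:
  fixes A :: "complex mat" and a b :: real
  assumes A: "A \<in> carrier_mat n n"
  defines "h \<equiv> fun_space.pencil (mat_form n (mat_Re A)) (std_form n) 1 (- a)"
    and "g \<equiv> fun_space.pencil (mat_form n (mat_Im A)) (std_form n) 1 (- b)"
  shows "Complex a b \<in> rank_numerical_range k A \<longleftrightarrow>
    (\<exists>S. fun_space.subspace S \<and> S \<subseteq> coord_space n \<and> fun_space.dim S = k \<and>
      (\<forall>u\<in>S. \<forall>w\<in>S. h u w = 0 \<and> g u w = 0))"
proof -
  have Re: "fun_space.hermitian_form (mat_form n (mat_Re A))"
    by (rule hermitian_mat_form[OF mat_Re_carrier[OF A] mat_adjoint_mat_Re[OF A]])
  have Im: "fun_space.hermitian_form (mat_form n (mat_Im A))"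
    by (rule hermitian_mat_form[OF mat_Im_carrier[OF A] mat_adjoint_mat_Im[OF A]])
  have h: "fun_space.hermitian_form h" unfolding h_def
    by (rule fun_space.hermitian_form_lincomb[OF Re hermitian_std_form])
  have g: "fun_space.hermitian_form g" unfolding g_def
    by (rule fun_space.hermitian_form_lincomb[OF Im hermitian_std_form])
  have F: "mat_form n A u w - Complex a b * std_form n u w = h u w + \<i> * g u w" for u w
    unfolding mat_form_Re_Im[OF A] h_def g_def Complex_eq by (simp add: algebra_simps)
  show ?thesis
  proof
    assume "Complex a b \<in> rank_numerical_range k A"
    then obtain X where X: "X \<in> carrier_mat n k" and XX: "mat_adjoint X * X = 1\<^sub>m k"
      and XA: "mat_adjoint X * A * X = Complex a b \<cdot>\<^sub>m 1\<^sub>m k"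
      using A unfolding rank_numerical_range_def by auto
    \<comment> \<open>The cutoff places the columns in \<open>coord_space n\<close>.\<close>
    define c where "c p = (\<lambda>i. if i < n then X $$ (i, p) else 0)" for p
    have N: "std_form n (c p) (c q) = (if p = q then 1 else 0)" if "p < k" "q < k" for p q
    proof -
      have "std_form n (c p) (c q) = (mat_adjoint X * X) $$ (p, q)"
        unfolding adjoint_mult_index[OF X that] by (rule mat_form_cong(2)) (simp_all add: c_def)
      then show ?thesis unfolding XX using that by simp
    qed
    have M: "mat_form n A (c p) (c q) = (if p = q then Complex a b else 0)" if "p < k" "q < k" for p q
    proof -
      have "mat_form n A (c p) (c q) = (mat_adjoint X * A * X) $$ (p, q)"
        unfolding adjoint_mult_mult_index[OF A X that] by (rule mat_form_cong(1)) (simp_all add: c_def)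
      then show ?thesis unfolding XA using that by simp
    qed
    \<comment> \<open>The single equation h + i g = 0 does not separate the two forms off the
      diagonal, where their values are complex. Conjugating the equation with p and q exchanged
      gives h - i g = 0.\<close>
    have z: "h (c p) (c q) = 0 \<and> g (c p) (c q) = 0" if "p < k" "q < k" for p q
    proof -
      have "h (c p) (c q) + \<i> * g (c p) (c q) = 0" unfolding F[symmetric] N[OF that] M[OF that] by simp
      moreover have "h (c q) (c p) + \<i> * g (c q) (c p) = 0" unfolding F[symmetric] N[OF that(2,1)] M[OF that(2,1)] by simp
      then have "cnj (h (c q) (c p) + \<i> * g (c q) (c p)) = 0" by simp
      then have "h (c p) (c q) - \<i> * g (c p) (c q) = 0"
        using fun_space.hermitian_form_cnj[OF h, of "c p" "c q"] fun_space.hermitian_form_cnj[OF g, of "c p" "c q"]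
        by simp
      ultimately show ?thesis by (simp add: complex_eq_iff)
    qed
    define C where "C = c ` {..<k}"
    have "inj_on c {..<k}"
    proof (rule inj_onI)
      fix p q assume "p \<in> {..<k}" "q \<in> {..<k}" "c p = c q"
      then show "p = q" using N[of p q] N[of p p] by (auto split: if_splits)
    qed
    then have cC: "card C = k" unfolding C_def by (simp add: card_image)
    have fC: "finite C" unfolding C_def by simp
    have oC: "fun_space.orthonormal (std_form n) C"
      unfolding fun_space.orthonormal_def C_def using N by auto (metis N zero_neq_one)+
    have "fun_space.dim (fun_space.span C) = k"
      using fun_space.orthonormal_card[OF hermitian_std_form fC oC] cC by simp
    moreover have "fun_space.span C \<subseteq> coord_space n"
      by (rule fun_space.span_minimal)
        (auto simp: C_def c_def coord_space_def fun_space.fin_subspace_imp_subspace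
          intro: fun_space.fin_subspace_imp_subspace[OF coord_space_fin, unfolded coord_space_def])
    moreover have "h u w = 0 \<and> g u w = 0" if "u \<in> fun_space.span C" "w \<in> fun_space.span C" for u w
      using fun_space.form_zero_on_span[OF h _ that] fun_space.form_zero_on_span[OF g _ that] z
      unfolding C_def by auto
    ultimately show "\<exists>S. fun_space.subspace S \<and> S \<subseteq> coord_space n \<and> fun_space.dim S = k \<and>
      (\<forall>u\<in>S. \<forall>w\<in>S. h u w = 0 \<and> g u w = 0)" using fun_space.subspace_span by blast
  next
    assume "\<exists>S. fun_space.subspace S \<and> S \<subseteq> coord_space n \<and> fun_space.dim S = k \<and>
      (\<forall>u\<in>S. \<forall>w\<in>S. h u w = 0 \<and> g u w = 0)"
    then obtain S where S: "fun_space.subspace S" "S \<subseteq> coord_space n" "fun_space.dim S = k"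
      and z: "\<And>u w. u \<in> S \<Longrightarrow> w \<in> S \<Longrightarrow> h u w = 0 \<and> g u w = 0" by blast
    obtain C where C: "finite C" "fun_space.orthonormal (std_form n) C" "S = fun_space.span C"
      using fun_space.orthonormal_basis_exists[OF hermitian_std_form
          fun_space.fin_subspace_subset[OF coord_space_fin S(1,2)]
          fun_space.pos_on_subset[OF pos_on_std_form S(2)]] .
    have cC: "card C = k" using fun_space.orthonormal_card[OF hermitian_std_form C(1,2)] C(3) S(3) by simp
    obtain c where c: "bij_betw c {0..<k} C" using ex_bij_betw_nat_finite[OF C(1)] cC by auto
    have cC: "c i \<in> C" if "i < k" for i using c that by (auto simp: bij_betw_def)
    have cS: "c i \<in> S" if "i < k" for i using cC[OF that] C(3) fun_space.span_base by auto
    have inj: "c i = c j \<longleftrightarrow> i = j" if "i < k" "j < k" for i j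
      using c that by (auto simp: bij_betw_def inj_on_def)
    have N: "std_form n (c p) (c q) = (if p = q then 1 else 0)" if "p < k" "q < k" for p q
      using C(2) cC that inj[OF that] unfolding fun_space.orthonormal_def by simp
    define X where "X = mat n k (\<lambda>(i, p). c p i)"
    have X: "X \<in> carrier_mat n k" unfolding X_def by simp
    have "mat_adjoint X * X = 1\<^sub>m k"
    proof (rule eq_matI)
      fix p q assume "p < dim_row (1\<^sub>m k)" "q < dim_col (1\<^sub>m k)"
      then have pq: "p < k" "q < k" by auto
      have "(mat_adjoint X * X) $$ (p, q) = std_form n (c p) (c q)"
        unfolding adjoint_mult_index[OF X pq] by (rule mat_form_cong(2)) (simp_all add: X_def pq)
      then show "(mat_adjoint X * X) $$ (p, q) = 1\<^sub>m k $$ (p, q)" using N[OF pq] pq by simp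
    qed (use X in auto)
    moreover have "mat_adjoint X * A * X = Complex a b \<cdot>\<^sub>m 1\<^sub>m k"
    proof (rule eq_matI)
      fix p q assume "p < dim_row (Complex a b \<cdot>\<^sub>m 1\<^sub>m k)" "q < dim_col (Complex a b \<cdot>\<^sub>m 1\<^sub>m k)"
      then have pq: "p < k" "q < k" by auto
      have "(mat_adjoint X * A * X) $$ (p, q) = mat_form n A (c p) (c q)"
        unfolding adjoint_mult_mult_index[OF A X pq] by (rule mat_form_cong(1)) (simp_all add: X_def pq)
      also have "\<dots> = Complex a b * std_form n (c p) (c q)"
        using F[of "c p" "c q"] z[OF cS[OF pq(1)] cS[OF pq(2)]] by simp
      finally show "(mat_adjoint X * A * X) $$ (p, q) = (Complex a b \<cdot>\<^sub>m 1\<^sub>m k) $$ (p, q)"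
        using N[OF pq] pq by simp
    qed (use X in auto)
    ultimately show "Complex a b \<in> rank_numerical_range k A"
      using X A unfolding rank_numerical_range_def by auto
  qed
qed

lemma herm_eigval_iff_pos_index_le:
  assumes M: "M \<in> carrier_mat n n" and herm: "fun_space.hermitian_form (mat_form n M)"
    and j: "1 \<le> j" "j \<le> n"
  shows "herm_eigval j M \<ge> c \<longleftrightarrow> fun_space.pos_index_le
      (\<lambda>u w. - fun_space.pencil (mat_form n M) (std_form n) 1 (- c) u w) (coord_space n) (n - j)"
    and "herm_eigval j M \<le> c \<longleftrightarrow> fun_space.pos_index_le
      (fun_space.pencil (mat_form n M) (std_form n) 1 (- c)) (coord_space n) (j - 1)"
  unfolding herm_eigval_def nth_rev_sorted_ge_iff[OF size_herm_eigvals[OF M] j]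
  by (rule herm_eigvals_count[OF M herm])+

lemma rank_numerical_range_iff_index_condition:
  assumes A: "A \<in> carrier_mat n n"
  shows "Complex a b \<in> rank_numerical_range k A \<longleftrightarrow> fun_space.index_condition
    (fun_space.pencil (mat_form n (mat_Re A)) (std_form n) 1 (- a))
    (fun_space.pencil (mat_form n (mat_Im A)) (std_form n) 1 (- b)) (coord_space n) k"
    (is "_ \<longleftrightarrow> fun_space.index_condition ?h ?g _ _")
proof -
  have h: "fun_space.hermitian_form ?h"
    by (intro fun_space.hermitian_form_lincomb hermitian_std_form
        hermitian_mat_form[OF mat_Re_carrier[OF A] mat_adjoint_mat_Re[OF A]])
  have g: "fun_space.hermitian_form ?g"
    by (intro fun_space.hermitian_form_lincomb hermitian_std_form
        hermitian_mat_form[OF mat_Im_carrier[OF A] mat_adjoint_mat_Im[OF A]])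
  show ?thesis
    unfolding rank_numerical_range_iff_isotropic[OF A]
    using fun_space.isotropic_subspace_exists[OF hermitian_std_form h g coord_space_fin pos_on_std_form]
      fun_space.index_condition_of_isotropic[OF coord_space_fin, of _ n ?h ?g] by blast
qed

section \<open>The conditions (a) to (f) as one index condition\<close>

theorem theorem4p1:
  fixes A :: "complex mat" and n k :: nat and a b :: real
  assumes "A \<in> carrier_mat n n" and "1 \<le> k" and "k \<le> n"
  shows
    "(Complex a b \<in> rank_numerical_range k A \<longleftrightarrow>
        (\<forall>t x y :: real. t + a * x + b * y = 0 \<longrightarrow>
          num_pos_eigvals (complex_of_real t \<cdot>\<^sub>m 1\<^sub>m n + complex_of_real x \<cdot>\<^sub>m mat_Re A
            + complex_of_real y \<cdot>\<^sub>m mat_Im A) \<le> n - k)) \<and>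
     (Complex a b \<in> rank_numerical_range k A \<longleftrightarrow>
        (\<forall>t x y :: real. t + a * x + b * y = 0 \<longrightarrow>
          num_neg_eigvals (complex_of_real t \<cdot>\<^sub>m 1\<^sub>m n + complex_of_real x \<cdot>\<^sub>m mat_Re A
            + complex_of_real y \<cdot>\<^sub>m mat_Im A) \<le> n - k)) \<and>
     (Complex a b \<in> rank_numerical_range k A \<longleftrightarrow>
        (\<forall>x y :: real.
          herm_eigval (n - k + 1) (complex_of_real x \<cdot>\<^sub>m mat_Re A + complex_of_real y \<cdot>\<^sub>m mat_Im A)
            \<le> a * x + b * y)) \<and>
     (Complex a b \<in> rank_numerical_range k A \<longleftrightarrow>
        (\<forall>x y :: real.
          herm_eigval k (complex_of_real x \<cdot>\<^sub>m mat_Re A + complex_of_real y \<cdot>\<^sub>m mat_Im A)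
            \<ge> a * x + b * y)) \<and>
     (Complex a b \<in> rank_numerical_range k A \<longleftrightarrow>
        (\<forall>y :: real.
          herm_eigval k (mat_Re A + complex_of_real y \<cdot>\<^sub>m mat_Im A) \<ge> a + b * y \<and>
          herm_eigval (n - k + 1) (mat_Re A + complex_of_real y \<cdot>\<^sub>m mat_Im A) \<le> a + b * y))"
proof -
  note A = assms(1) and k = assms(2,3)
  define U where "U = coord_space n"
  define N where "N = std_form n"
  define HR where "HR = mat_form n (mat_Re A)"
  define HI where "HI = mat_form n (mat_Im A)"
  define h where "h = fun_space.pencil HR N 1 (- a)"
  define g where "g = fun_space.pencil HI N 1 (- b)"
  have dim: "fun_space.dim U = n" unfolding U_def by (rule dim_coord_space)
  have kU: "k \<le> fun_space.dim U" using k dim by simp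
  have Nh: "fun_space.hermitian_form N" unfolding N_def by (rule hermitian_std_form)
  have HRh: "fun_space.hermitian_form HR" unfolding HR_def
    by (rule hermitian_mat_form[OF mat_Re_carrier[OF A] mat_adjoint_mat_Re[OF A]])
  have HIh: "fun_space.hermitian_form HI" unfolding HI_def
    by (rule hermitian_mat_form[OF mat_Im_carrier[OF A] mat_adjoint_mat_Im[OF A]])
  have h: "fun_space.hermitian_form h" unfolding h_def by (rule fun_space.hermitian_form_lincomb[OF HRh Nh])
  have g: "fun_space.hermitian_form g" unfolding g_def by (rule fun_space.hermitian_form_lincomb[OF HIh Nh])
  have mem: "Complex a b \<in> rank_numerical_range k A \<longleftrightarrow> fun_space.index_condition h g U k"
    unfolding h_def g_def HR_def HI_def N_def U_def by (rule rank_numerical_range_iff_index_condition[OF A])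
  define L where "L x y = complex_of_real x \<cdot>\<^sub>m mat_Re A + complex_of_real y \<cdot>\<^sub>m mat_Im A" for x y
  define T where "T t x y = complex_of_real t \<cdot>\<^sub>m 1\<^sub>m n + complex_of_real x \<cdot>\<^sub>m mat_Re A
      + complex_of_real y \<cdot>\<^sub>m mat_Im A" for t x y
  note cR = mat_Re_carrier[OF A] and cI = mat_Im_carrier[OF A]
  have L: "L x y \<in> carrier_mat n n" for x y unfolding L_def using cR cI by simp
  have T: "T t x y \<in> carrier_mat n n" for t x y unfolding T_def using cR cI by simp
  have Lf: "mat_form n (L x y) = fun_space.pencil HR HI x y" for x y
    unfolding L_def HR_def HI_def
    by (intro ext) (simp only: mat_form_add[OF smult_carrier_mat[OF cR] smult_carrier_mat[OF cI]]
        mat_form_smult[OF cR] mat_form_smult[OF cI])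
  have Tf: "mat_form n (T t x y) = fun_space.pencil N (fun_space.pencil HR HI x y) t 1" for t x y
    unfolding T_def HR_def HI_def N_def
    by (intro ext) (simp add: mat_form_add[OF add_carrier_mat[OF smult_carrier_mat[OF cR]] smult_carrier_mat[OF cI]]
        mat_form_add[OF smult_carrier_mat[OF one_carrier_mat] smult_carrier_mat[OF cR]]
        mat_form_smult[OF cR] mat_form_smult[OF cI] mat_form_smult[OF one_carrier_mat] mat_form_one)
  have Lh: "fun_space.hermitian_form (mat_form n (L x y))" for x y
    unfolding Lf by (rule fun_space.hermitian_form_lincomb[OF HRh HIh])
  have Th: "fun_space.hermitian_form (mat_form n (T t x y))" for t x y
    unfolding Tf by (intro fun_space.hermitian_form_lincomb HRh HIh Nh)
  \<comment> \<open>The level a x + b y splits into the shift by a of the real part and by b of the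
    imaginary part, so comparing eigenvalues with this level is an index question at level 0 for the
    shifted pencil.\<close>
  have Lp: "fun_space.pencil (mat_form n (L x y)) N 1 (- (a * x + b * y)) = fun_space.pencil h g x y" for x y
    unfolding Lf h_def g_def by (intro ext) (simp add: algebra_simps)
  \<comment> \<open>On the plane t + a x + b y = 0 the summand t I performs the same shift; - 0 is
    the shape in which \<open>herm_eigvals_count\<close> delivers it.\<close>
  have Tp: "fun_space.pencil (mat_form n (T t x y)) N 1 (- 0) = fun_space.pencil h g x y"
    if "t + a * x + b * y = 0" for t x y
  proof -
    have t: "t = - (a * x + b * y)" using that by simp
    show ?thesis unfolding Tf h_def g_def t by (intro ext) (simp add: algebra_simps)
  qed
  have pos: "num_pos_eigvals (T t x y) \<le> m \<longleftrightarrow> fun_space.pos_index_le (fun_space.pencil h g x y) U m"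
    if "t + a * x + b * y = 0" for t x y m
    unfolding num_pos_eigvals_def herm_eigvals_count(1)[OF T Th] N_def[symmetric] U_def[symmetric] Tp[OF that] ..
  have neg: "num_neg_eigvals (T t x y) \<le> m \<longleftrightarrow>
      fun_space.pos_index_le (\<lambda>u w. - fun_space.pencil h g x y u w) U m"
    if "t + a * x + b * y = 0" for t x y m
  proof -
    have "(\<lambda>u w. - fun_space.pencil (mat_form n (T t x y)) N 1 (- 0) u w)
        = (\<lambda>u w. - fun_space.pencil h g x y u w)" using Tp[OF that] by metis
    then show ?thesis
      unfolding num_neg_eigvals_def herm_eigvals_count(2)[OF T Th] N_def[symmetric] U_def[symmetric] by simp
  qed
  have ge: "herm_eigval k (L x y) \<ge> a * x + b * y \<longleftrightarrow>
      fun_space.pos_index_le (\<lambda>u w. - fun_space.pencil h g x y u w) U (n - k)" for x y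
  proof -
    have "(\<lambda>u w. - fun_space.pencil (mat_form n (L x y)) N 1 (- (a * x + b * y)) u w)
        = (\<lambda>u w. - fun_space.pencil h g x y u w)" using Lp by metis
    then show ?thesis
      unfolding herm_eigval_iff_pos_index_le(1)[OF L Lh k] N_def[symmetric] U_def[symmetric] by simp
  qed
  \<comment> \<open>At position n - k + 1 the bound j - 1 of
    \<open>herm_eigval_iff_pos_index_le\<close> is n - k, the same as the bound n - j at position k.
    The position is valid because k is at least 1.\<close>
  have j: "1 \<le> n - k + 1" "n - k + 1 \<le> n" using k by auto
  have le: "herm_eigval (n - k + 1) (L x y) \<le> a * x + b * y \<longleftrightarrow>
      fun_space.pos_index_le (fun_space.pencil h g x y) U (n - k)" for x y
    unfolding herm_eigval_iff_pos_index_le(2)[OF L Lh j] N_def[symmetric] U_def[symmetric] Lp by simp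
  have L1: "mat_Re A + complex_of_real y \<cdot>\<^sub>m mat_Im A = L 1 y" for y
    unfolding L_def by (intro arg_cong2[of _ _ _ _ "(+)"] eq_matI) auto
  \<comment> \<open>Each (x, y) has exactly one \<open>t\<close> on the plane, so the quantifier
    over \<open>t\<close> disappears.\<close>
  have "(\<forall>t x y. t + a * x + b * y = 0 \<longrightarrow> num_pos_eigvals (T t x y) \<le> n - k) \<longleftrightarrow>
      (\<forall>x y. fun_space.pos_index_le (fun_space.pencil h g x y) U (n - k))"
  proof (intro iffI allI impI)
    fix x y assume *: "\<forall>t x y. t + a * x + b * y = 0 \<longrightarrow> num_pos_eigvals (T t x y) \<le> n - k"
    have "- (a * x + b * y) + a * x + b * y = 0" by simp
    then show "fun_space.pos_index_le (fun_space.pencil h g x y) U (n - k)" using * pos by blast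
  qed (use pos in blast)
  then have b: "Complex a b \<in> rank_numerical_range k A \<longleftrightarrow>
      (\<forall>t x y. t + a * x + b * y = 0 \<longrightarrow> num_pos_eigvals (T t x y) \<le> n - k)"
    using fun_space.index_condition_iff_pos_index_le[OF kU, of h g] unfolding mem dim by blast
  have "(\<forall>t x y. t + a * x + b * y = 0 \<longrightarrow> num_neg_eigvals (T t x y) \<le> n - k) \<longleftrightarrow>
      (\<forall>x y. fun_space.pos_index_le (\<lambda>u w. - fun_space.pencil h g x y u w) U (n - k))"
  proof (intro iffI allI impI)
    fix x y assume *: "\<forall>t x y. t + a * x + b * y = 0 \<longrightarrow> num_neg_eigvals (T t x y) \<le> n - k"
    have "- (a * x + b * y) + a * x + b * y = 0" by simp
    then show "fun_space.pos_index_le (\<lambda>u w. - fun_space.pencil h g x y u w) U (n - k)" using * neg by blast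
  qed (use neg in blast)
  then have c: "Complex a b \<in> rank_numerical_range k A \<longleftrightarrow>
      (\<forall>t x y. t + a * x + b * y = 0 \<longrightarrow> num_neg_eigvals (T t x y) \<le> n - k)"
    using fun_space.index_condition_iff_neg_index_le[OF kU, of h g] unfolding mem dim by blast
  have d: "Complex a b \<in> rank_numerical_range k A \<longleftrightarrow>
      (\<forall>x y. herm_eigval (n - k + 1) (L x y) \<le> a * x + b * y)"
    unfolding mem le fun_space.index_condition_iff_pos_index_le[OF kU, of h g] dim ..
  have e: "Complex a b \<in> rank_numerical_range k A \<longleftrightarrow>
      (\<forall>x y. herm_eigval k (L x y) \<ge> a * x + b * y)"
    unfolding mem ge fun_space.index_condition_iff_neg_index_le[OF kU, of h g] dim ..
  have f: "Complex a b \<in> rank_numerical_range k A \<longleftrightarrow>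
      (\<forall>y. herm_eigval k (L 1 y) \<ge> a + b * y \<and> herm_eigval (n - k + 1) (L 1 y) \<le> a + b * y)"
    using fun_space.index_condition_iff_affine[OF h g _ kU] ge[of 1] le[of 1]
    unfolding mem dim by (simp add: U_def coord_space_fin)
  show ?thesis
    unfolding L1 using b c d e f unfolding L_def T_def by blast
qed

end
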